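(* Let $1<t<3/2$ and let $p,q$ satisfy $\left(\frac1p,\frac1q\right)\in(0,1)^2$ and $\frac1q-\frac1p=2t-2$. Then for every $0<r<\infty$, the operator $$K_{2t}f(z):=\int_{\mathbb D}\frac{f(w)}{(1-z\overline w)^{2t}}\,dA(w)$$ extends to a bounded map $K_{2t}:L^{p,r}(\mathbb D)\to L^{q,r}(\mathbb D)$. In particular, $K_{2t}:L^p(\mathbb D)\to L^{q,\infty}(\mathbb D)$ is bounded.
   Context: $\mathbb D$ is the open unit disc in $\mathbb C$, $dA$ is normalized area measure on $\mathbb D$, $|E|$ is the $dA$-measure of $E$, and $L^p(\mathbb D)$ is taken with respect to $dA$. For $1\le p<\infty$ and $0<r<\infty$ the Lorentz space $L^{p,r}(\mathbb D)$ is defined by finiteness of $\|f\|_{L^{p,r}(\mathbb D)}:=\left(p\int_0^\infty\lambda^r|\{z\in\mathbb D:|f(z)|>\lambda\}|^{r/p}\frac{d\lambda}\lambda\right)^{1/r}$, and $\|f\|_{L^{q,\infty}(\mathbb D)}:=\sup_{\lambda>0}\lambda|\{z\in\mathbb D:|f(z)|>\lambda\}|^{1/q}$. *)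

theory Defs
  imports "HOL-Analysis.Analysis"
begin

abbreviation unit_disc :: "complex set" where
  "unit_disc \<equiv> ball 0 1"

definition disc_area :: "complex measure" where
  "disc_area = scale_measure (ennreal (1 / pi)) (lebesgue_on unit_disc)"

text \<open>
  Powers of extended nonnegative reals; only used with exponents \<open>a > 0\<close>.
\<close>

definition epowr :: "ennreal \<Rightarrow> real \<Rightarrow> ennreal" where
  "epowr x a = (if x = \<infinity> then \<infinity> else ennreal (enn2real x powr a))"

text \<open>
  Elements of the function spaces are represented by functions on \<open>\<complex>\<close>, of which only the
  restriction to the disc matters (the space of the measure \<open>disc_area\<close> is the disc). As the disc
  has finite measure, the distribution function is real-valued.
\<close>

definition distr_fun :: "(complex \<Rightarrow> complex) \<Rightarrow> real \<Rightarrow> real" where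
  "distr_fun f s = measure disc_area {z \<in> unit_disc. cmod (f z) > s}"

definition lorentz_norm :: "real \<Rightarrow> real \<Rightarrow> (complex \<Rightarrow> complex) \<Rightarrow> ennreal" where
  "lorentz_norm p r f =
     epowr (ennreal p * (\<integral>\<^sup>+s\<in>{0<..}. ennreal (s powr r * distr_fun f s powr (r / p) / s) \<partial>lborel))
       (1 / r)"

definition lorentz_space :: "real \<Rightarrow> real \<Rightarrow> (complex \<Rightarrow> complex) set" where
  "lorentz_space p r = {f \<in> borel_measurable disc_area. lorentz_norm p r f < \<infinity>}"

definition weak_norm :: "real \<Rightarrow> (complex \<Rightarrow> complex) \<Rightarrow> ennreal" where
  "weak_norm q f = (SUP s\<in>{0<..}. ennreal (s * distr_fun f s powr (1 / q)))"

definition weak_space :: "real \<Rightarrow> (complex \<Rightarrow> complex) set" where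
  "weak_space q = {f \<in> borel_measurable disc_area. weak_norm q f < \<infinity>}"

definition Lp_norm :: "real \<Rightarrow> (complex \<Rightarrow> complex) \<Rightarrow> ennreal" where
  "Lp_norm p f = epowr (\<integral>\<^sup>+z. ennreal (cmod (f z) powr p) \<partial>disc_area) (1 / p)"

definition Lp_space :: "real \<Rightarrow> (complex \<Rightarrow> complex) set" where
  "Lp_space p = {f \<in> borel_measurable disc_area. Lp_norm p f < \<infinity>}"

text \<open>
  The complex power is the principal one; the real part of \<open>1 - z * cnj w\<close> is positive for
  \<open>z\<close> and \<open>w\<close> in the disc.
\<close>

definition K_integrand :: "real \<Rightarrow> (complex \<Rightarrow> complex) \<Rightarrow> complex \<Rightarrow> complex \<Rightarrow> complex" where
  "K_integrand a f z w = f w / (1 - z * cnj w) powr complex_of_real a"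

definition K_op :: "real \<Rightarrow> (complex \<Rightarrow> complex) \<Rightarrow> complex \<Rightarrow> complex" where
  "K_op a f z = (\<integral>w. K_integrand a f z w \<partial>disc_area)"

text \<open>
  The operator is bounded from \<open>X\<close> to \<open>Y\<close>. The Bochner integral is \<open>0\<close> by convention for a
  non-integrable integrand, so convergence of the defining integral at every point of the disc is
  part of the definition; thus the extension of the operator to \<open>X\<close> is given by the same integral.
\<close>

definition K_bounded ::
  "real \<Rightarrow> (complex \<Rightarrow> complex) set \<Rightarrow> ((complex \<Rightarrow> complex) \<Rightarrow> ennreal) \<Rightarrow>
    (complex \<Rightarrow> complex) set \<Rightarrow> ((complex \<Rightarrow> complex) \<Rightarrow> ennreal) \<Rightarrow> bool" where
  "K_bounded a X norm_X Y norm_Y \<longleftrightarrow>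
     (\<exists>C::real. \<forall>f\<in>X. (\<forall>z\<in>unit_disc. integrable disc_area (K_integrand a f z)) \<and>
        K_op a f \<in> Y \<and> norm_Y (K_op a f) \<le> ennreal C * norm_X f)"

end

theory Submission
  imports Defs
begin

text \<open>
  Write \<open>a = 2 * t - 2 > 0\<close>, so that \<open>1 / q = 1 / p + a\<close>. The size of the kernel suggests to split off a
  power of the distance to the circle: \<open>\<bar>K\<^bsub>2t\<^esub> f(z)\<bar> \<le> (1 - \<bar>z\<bar>)\<^bsup>-a\<^esup> S\<bar>f\<bar>(z)\<close>, where \<open>S\<close> has the positive
  kernel \<open>(1 - \<bar>z\<bar>)\<^bsup>a\<^esup> / \<bar>1 - z cnj w\<bar>\<^bsup>2+a\<^esup>\<close>. The operator \<open>S\<close> loses no integrability: it is of weak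
  type \<open>(p0, p0)\<close> for all \<open>p0 > 1\<close>, hence bounded on every \<open>L\<^bsup>p,r\<^esup>\<close> with \<open>p > 1\<close>. The factor
  \<open>(1 - \<bar>z\<bar>)\<^bsup>-a\<^esup>\<close> lies in \<open>L\<^bsup>1/a,\<infinity>\<^esup>\<close>, because the annulus \<open>1 - \<bar>z\<bar> < x\<close> has area at most \<open>2 x\<close>, and
  multiplication by a function in weak \<open>L\<^bsup>1/a\<^esup>\<close> maps \<open>L\<^bsup>p,r\<^esup>\<close> to \<open>L\<^bsup>q,r\<^esup>\<close> (Hoelder's inequality of O'Neil).

  For the weak type of \<open>S\<close>, the Schur test is merged with Young's inequality. With
  \<open>X = (1 - \<bar>w\<bar>) / (1 - \<bar>z\<bar>)\<close> one has
  \<open>f \<le> M\<^bsup>1-p0\<^esup> f\<^bsup>p0\<^esup> X\<^bsup>(p0-1)\<beta>\<^esup> + M X\<^bsup>-\<beta>\<^esup>\<close> (\<open>weighted_young\<close>). Against the kernel, the weight in the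
  first term is integrable in \<open>z\<close> and the weight in the second is integrable in \<open>w\<close>, both uniformly;
  this is the Forelli--Rudin estimate, proved by a dyadic decomposition from the area of Carleson
  boxes (\<open>carleson_box_area\<close>). Integration over \<open>F\<close>, the set where \<open>S f\<close> exceeds a multiple of \<open>M\<close>,
  then yields \<open>M\<^bsup>p0\<^esup> \<bar>F\<bar> \<le> \<integral> f\<^bsup>p0\<^esup>\<close>, and since the part of \<open>f\<close> below \<open>M\<close> contributes at most a multiple
  of \<open>M\<close>, the integral need only run over \<open>f > M\<close> (\<open>disc_op_weak_type\<close>).

  The passage to Lorentz spaces happens on the level of distribution functions. The weak type bound
  says that the distribution function of \<open>S f\<close> is dominated by a sum over dyadic dilates of the one
  of \<open>f\<close>, which a Hardy type inequality turns into a norm bound (\<open>layer_int_hardy\<close>). The multiplier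
  is handled in \<open>layer_int_weak_multiplier\<close>. Both arguments are uniform in \<open>r\<close>, so that
  no distinction between the normed and the quasi-normed range is made. The weak bound on
  \<open>L\<^bsup>p\<^esup>\<close> is the case \<open>r = p\<close>, as \<open>L\<^bsup>p\<^esup> = L\<^bsup>p,p\<^esup>\<close> and \<open>L\<^bsup>q,p\<^esup>\<close> embeds in \<open>L\<^bsup>q,\<infinity>\<^esup>\<close>.
\<close>

section \<open>Area in the disc\<close>

lemma measurable_Complex_pair: "(\<lambda>(x, y). Complex x y) \<in> (lborel \<Otimes>\<^sub>M lborel) \<rightarrow>\<^sub>M borel"
proof -
  have "(\<lambda>(x, y). Complex x y) = (\<lambda>p. complex_of_real (fst p) + \<i> * complex_of_real (snd p))"
    by (auto simp: fun_eq_iff complex_eq_iff)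
  moreover have "\<dots> \<in> (lborel \<Otimes>\<^sub>M lborel) \<rightarrow>\<^sub>M borel"
    by measurable
  ultimately show ?thesis by metis
qed

lemma lborel_complex_conv_pair:
  "(lborel :: complex measure) = distr (lborel \<Otimes>\<^sub>M lborel) borel (\<lambda>(x, y). Complex x y)"
proof (rule lborel_eqI)
  fix l u :: complex
  assume lu: "\<And>b. b \<in> Basis \<Longrightarrow> l \<bullet> b \<le> u \<bullet> b"
  have le: "Re l \<le> Re u" "Im l \<le> Im u"
    using lu[of 1] lu[of \<i>] by (auto simp: Basis_complex_def inner_complex_def)
  have "(\<lambda>(x, y). Complex x y) -` box l u \<inter> space (lborel \<Otimes>\<^sub>M lborel) =
      {Re l<..<Re u} \<times> {Im l<..<Im u}"
    by (auto simp: box_def Basis_complex_def inner_complex_def space_pair_measure)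
  then have "emeasure (distr (lborel \<Otimes>\<^sub>M lborel) borel (\<lambda>(x, y). Complex x y)) (box l u) =
      emeasure (lborel \<Otimes>\<^sub>M lborel) ({Re l<..<Re u} \<times> {Im l<..<Im u})"
    by (subst emeasure_distr[OF measurable_Complex_pair]) auto
  also have "\<dots> = ennreal (Re u - Re l) * ennreal (Im u - Im l)"
    using le by (subst sigma_finite_measure.emeasure_pair_measure_Times) (auto intro: lborel.sigma_finite_measure_axioms)
  also have "\<dots> = ennreal (\<Prod>b\<in>Basis. (u - l) \<bullet> b)"
    using le by (simp add: Basis_complex_def inner_complex_def ennreal_mult)
  finally show "emeasure (distr (lborel \<Otimes>\<^sub>M lborel) borel (\<lambda>(x, y). Complex x y)) (box l u)
      = (\<Prod>b\<in>Basis. (u - l) \<bullet> b)" by simp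
qed simp

lemma emeasure_complex_slices:
  fixes A :: "complex set"
  assumes A: "A \<in> sets borel"
  shows emeasure_complex_Re_slices: "emeasure lborel A = (\<integral>\<^sup>+v. emeasure lborel {s. Complex s v \<in> A} \<partial>lborel)"
    and emeasure_complex_Im_slices: "emeasure lborel A = (\<integral>\<^sup>+s. emeasure lborel {v. Complex s v \<in> A} \<partial>lborel)"
proof -
  let ?B = "(\<lambda>(x, y). Complex x y) -` A \<inter> space (lborel \<Otimes>\<^sub>M lborel)"
  have B: "?B \<in> sets (lborel \<Otimes>\<^sub>M lborel)"
    using measurable_Complex_pair A by (rule measurable_sets)
  have *: "emeasure lborel A = emeasure (lborel \<Otimes>\<^sub>M lborel) ?B"
    by (subst lborel_complex_conv_pair, subst emeasure_distr[OF measurable_Complex_pair A]) simp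
  show "emeasure lborel A = (\<integral>\<^sup>+v. emeasure lborel {s. Complex s v \<in> A} \<partial>lborel)"
    unfolding * lborel_pair.emeasure_pair_measure_alt2[OF B]
    by (intro nn_integral_cong arg_cong[where f = "emeasure lborel"]) (auto simp: space_pair_measure)
  show "emeasure lborel A = (\<integral>\<^sup>+s. emeasure lborel {v. Complex s v \<in> A} \<partial>lborel)"
    unfolding * lborel.emeasure_pair_measure_alt[OF B]
    by (intro nn_integral_cong arg_cong[where f = "emeasure lborel"]) (auto simp: space_pair_measure)
qed

lemma borel_measurable_cnj [measurable]: "cnj \<in> borel_measurable borel"
  by (intro borel_measurable_continuous_onI continuous_intros)

lemma space_disc_area [simp]: "space disc_area = unit_disc"
  by (simp add: disc_area_def space_scale_measure space_restrict_space)

lemma measurable_ident_disc_area [measurable]: "(\<lambda>z. z) \<in> disc_area \<rightarrow>\<^sub>M borel"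
proof -
  have "(\<lambda>z::complex. z) \<in> lebesgue_on unit_disc \<rightarrow>\<^sub>M borel"
    by (intro measurable_restrict_space1 measurable_completion) auto
  then show ?thesis
    by (simp add: disc_area_def measurable_def space_scale_measure)
qed

lemma sets_disc_area_borel:
  assumes "A \<in> sets borel" "A \<subseteq> unit_disc"
  shows "A \<in> sets disc_area"
  using measurable_sets[OF measurable_ident_disc_area assms(1)] assms(2)
  by (simp add: Int_absorb2)

lemma emeasure_disc_area_borel:
  assumes "A \<in> sets borel" "A \<subseteq> unit_disc"
  shows "emeasure disc_area A = ennreal (1 / pi) * emeasure lborel A"
  using assms
  by (simp add: disc_area_def emeasure_restrict_space)

lemma emeasure_disc_area_ball:
  assumes "0 \<le> r" "r \<le> 1"
  shows "emeasure disc_area (ball 0 r) = ennreal (r ^ 2)"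
proof -
  have "emeasure disc_area (ball 0 r) = ennreal (1 / pi) * emeasure lborel (ball (0::complex) r)"
    using assms by (intro emeasure_disc_area_borel) auto
  also have "emeasure lborel (ball (0::complex) r) = ennreal (pi * r ^ 2)"
    using assms by (simp add: emeasure_ball unit_ball_vol_2)
  finally show ?thesis
    by (simp add: ennreal_mult[symmetric])
qed

lemma finite_measure_disc_area: "finite_measure disc_area"
  by (rule finite_measureI) (use emeasure_disc_area_ball[of 1] in simp)

interpretation disc_area: finite_measure disc_area
  by (rule finite_measure_disc_area)

lemma measure_disc_area_UNIV [simp]: "measure disc_area unit_disc = 1"
  using emeasure_disc_area_ball[of 1] by (simp add: measure_def)

lemma measure_disc_area_le_1: "measure disc_area A \<le> 1"
  using disc_area.bounded_measure[of A] by simp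

lemma emeasure_near_circle:
  assumes "x > 0"
  shows "emeasure disc_area {w \<in> unit_disc. 1 - cmod w < x} \<le> ennreal (2 * x)"
proof (cases "x \<le> 1")
  case True
  have meas: "ball 0 (1 - x) \<in> sets disc_area"
    using assms by (intro sets_disc_area_borel) auto
  have "emeasure disc_area {w \<in> unit_disc. 1 - cmod w < x} \<le> emeasure disc_area (unit_disc - ball 0 (1 - x))"
    using meas sets_disc_area_borel[of unit_disc] by (intro emeasure_mono) auto
  also have "\<dots> = emeasure disc_area unit_disc - emeasure disc_area (ball 0 (1 - x))"
    using meas assms sets_disc_area_borel[of unit_disc] by (intro emeasure_Diff) auto
  also have "\<dots> = ennreal (1 - (1 - x)\<^sup>2)"
    using True assms by (simp add: emeasure_disc_area_ball ennreal_minus flip: ennreal_1)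
  also have "\<dots> \<le> ennreal (2 * x)"
    by (intro ennreal_leI) (simp add: power2_eq_square algebra_simps)
  finally show ?thesis .
next
  case False
  have "emeasure disc_area {w \<in> unit_disc. 1 - cmod w < x} \<le> emeasure disc_area unit_disc"
    using sets_disc_area_borel[of unit_disc] by (intro emeasure_mono) auto
  also have "\<dots> = ennreal 1" using emeasure_disc_area_ball[of 1] by simp
  also have "\<dots> \<le> ennreal (2 * x)" using False by (intro ennreal_leI) simp
  finally show ?thesis .
qed

lemma emeasure_small_diameter:
  fixes A :: "real set"
  assumes "\<And>s s'. s \<in> A \<Longrightarrow> s' \<in> A \<Longrightarrow> \<bar>s - s'\<bar> \<le> d" "d \<ge> 0"
  shows "emeasure lborel A \<le> ennreal (2 * d)"
proof (cases "A = {}")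
  case False
  then obtain m where m: "m \<in> A" by auto
  have "A \<subseteq> {m - d..m + d}"
  proof
    fix s assume "s \<in> A"
    from assms(1)[OF this m] show "s \<in> {m - d..m + d}" by auto
  qed
  then have "emeasure lborel A \<le> emeasure lborel {m - d..m + d}"
    by (intro emeasure_mono) auto
  then show ?thesis using assms(2) by simp
qed simp

text \<open>
  A thin annulus meets a line in short segments wherever the line crosses the circle transversally;
  that the coordinate along the line stays away from \<open>0\<close> is what excludes tangency.
\<close>

lemma abs_diff_le_of_squares:
  fixes s s' :: real
  assumes "s\<^sup>2 + v \<in> {1 - 2 * x..1}" "s'\<^sup>2 + v \<in> {1 - 2 * x..1}"
    and "(s \<ge> 1 / 5 \<and> s' \<ge> 1 / 5) \<or> (s \<le> - 1 / 5 \<and> s' \<le> - 1 / 5)"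
  shows "\<bar>s - s'\<bar> \<le> 5 * x"
proof -
  have "\<bar>s - s'\<bar> * (2 / 5) \<le> \<bar>s - s'\<bar> * \<bar>s + s'\<bar>"
    using assms(3) by (intro mult_left_mono) auto
  also have "\<dots> = \<bar>s\<^sup>2 - s'\<^sup>2\<bar>"
    by (simp add: abs_mult[symmetric] power2_eq_square algebra_simps)
  also have "\<dots> \<le> 2 * x" using assms(1,2) by (auto simp: abs_if)
  finally show ?thesis by simp
qed

text \<open>
  One of the coordinates of \<open>u\<close> is large, and it stays large on the box because the box is small.
  Slicing in the direction of this coordinate gives transversal intersections with the annulus, so
  Fubini's theorem bounds the area without polar coordinates.
\<close>

lemma carleson_box_near_point:
  fixes u :: complex
  assumes u: "cmod u = 1" and x: "x > 0" and y: "0 < y" "y < 1 / 2"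
  shows "emeasure lborel {w \<in> unit_disc. 1 - cmod w < x \<and> cmod (w - u) < y} \<le> ennreal (20 * x * y)"
proof -
  define A where "A = {w \<in> unit_disc. 1 - cmod w < x \<and> cmod (w - u) < y}"
  have A_borel: "A \<in> sets borel"
    unfolding A_def by measurable
  have A_sq: "(Re w)\<^sup>2 + (Im w)\<^sup>2 \<in> {1 - 2 * x..1}" if "w \<in> A" for w
  proof -
    have w: "cmod w < 1" "1 - x < cmod w" using that by (auto simp: A_def)
    have "1 - 2 * x \<le> (cmod w)\<^sup>2"
    proof (cases "x \<le> 1")
      case True
      then have "(1 - x)\<^sup>2 \<le> (cmod w)\<^sup>2" using w by (intro power_mono) auto
      then show ?thesis by (simp add: power2_eq_square algebra_simps) (use mult_nonneg_nonneg[of x x] x in linarith)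
    next
      case False
      then show ?thesis using zero_le_power2[of "cmod w"] by linarith
    qed
    moreover have "(cmod w)\<^sup>2 \<le> 1" using w by (simp add: power_le_one)
    ultimately show ?thesis by (simp add: cmod_power2)
  qed
  have A_near: "\<bar>Re w - Re u\<bar> < y" "\<bar>Im w - Im u\<bar> < y" if "w \<in> A" for w
    using that abs_Re_le_cmod[of "w - u"] abs_Im_le_cmod[of "w - u"] by (auto simp: A_def)
  \<comment> \<open>\<open>7 / 10\<close> is below \<open>1 / sqrt 2\<close>, and \<open>7 / 10 - y\<close> is at least \<open>1 / 5\<close>.\<close>
  have large: "\<bar>Re u\<bar> \<ge> 7 / 10 \<or> \<bar>Im u\<bar> \<ge> 7 / 10"
  proof (rule ccontr)
    assume "\<not> ?thesis"
    then have "(Re u)\<^sup>2 < (7 / 10)\<^sup>2" "(Im u)\<^sup>2 < (7 / 10)\<^sup>2"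
      by (auto simp: abs_square_less_1 abs_less_iff intro!: power2_strict_mono)
    moreover have "(Re u)\<^sup>2 + (Im u)\<^sup>2 = 1" using u by (simp add: cmod_power2[symmetric])
    ultimately show False by (simp add: power2_eq_square)
  qed
  \<comment> \<open>Each slice in the direction of the larger coordinate of \<open>u\<close> has diameter at most \<open>5 * x\<close>,
    and the slices that meet the box are parametrised by an interval of length \<open>2 * y\<close>.\<close>
  have key: "(\<integral>\<^sup>+v. emeasure lborel (S v) \<partial>lborel) \<le> ennreal (20 * x * y)"
    if S: "\<And>v s. s \<in> S v \<Longrightarrow> \<bar>v - c\<bar> < y" "\<And>v s s'. s \<in> S v \<Longrightarrow> s' \<in> S v \<Longrightarrow> \<bar>s - s'\<bar> \<le> 5 * x"
    for S :: "real \<Rightarrow> real set" and c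
  proof -
    have "(\<integral>\<^sup>+v. emeasure lborel (S v) \<partial>lborel) \<le> (\<integral>\<^sup>+v. ennreal (10 * x) * indicator {c - y..c + y} v \<partial>lborel)"
    proof (rule nn_integral_mono)
      fix v :: real
      show "emeasure lborel (S v) \<le> ennreal (10 * x) * indicator {c - y..c + y} v"
      proof (cases "S v = {}")
        case False
        then have "v \<in> {c - y..c + y}" using S(1)[of _ v] by fastforce
        moreover have "emeasure lborel (S v) \<le> ennreal (2 * (5 * x))"
          using S(2)[of _ v] x by (intro emeasure_small_diameter) auto
        ultimately show ?thesis by simp
      qed simp
    qed
    also have "\<dots> = ennreal (10 * x) * ennreal (2 * y)"
      using y by (subst nn_integral_cmult_indicator) auto
    also have "\<dots> = ennreal (20 * x * y)"
      using x y by (simp add: ennreal_mult[symmetric] algebra_simps)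
    finally show ?thesis .
  qed
  have "emeasure lborel A \<le> ennreal (20 * x * y)"
    using large
  proof
    assume Re: "7 / 10 \<le> \<bar>Re u\<bar>"
    show ?thesis
      unfolding emeasure_complex_Re_slices[OF A_borel]
    proof (rule key)
      fix v s assume "s \<in> {s. Complex s v \<in> A}"
      then show "\<bar>v - Im u\<bar> < y" using A_near[of "Complex s v"] by auto
    next
      fix v s s' assume "s \<in> {s. Complex s v \<in> A}" "s' \<in> {s. Complex s v \<in> A}"
      then have *: "Complex s v \<in> A" "Complex s' v \<in> A" by auto
      show "\<bar>s - s'\<bar> \<le> 5 * x"
        using A_sq[OF *(1)] A_sq[OF *(2)] A_near[OF *(1)] A_near[OF *(2)] Re y
        by (intro abs_diff_le_of_squares[of s "v\<^sup>2" x s']) auto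
    qed
  next
    assume Im: "7 / 10 \<le> \<bar>Im u\<bar>"
    show ?thesis
      unfolding emeasure_complex_Im_slices[OF A_borel]
    proof (rule key)
      fix v s assume "s \<in> {s. Complex v s \<in> A}"
      then show "\<bar>v - Re u\<bar> < y" using A_near[of "Complex v s"] by auto
    next
      fix v s s' assume "s \<in> {s. Complex v s \<in> A}" "s' \<in> {s. Complex v s \<in> A}"
      then have *: "Complex v s \<in> A" "Complex v s' \<in> A" by auto
      show "\<bar>s - s'\<bar> \<le> 5 * x"
        using A_sq[OF *(1)] A_sq[OF *(2)] A_near[OF *(1)] A_near[OF *(2)] Im y
        by (intro abs_diff_le_of_squares[of s "v\<^sup>2" x s']) (auto simp: add.commute)
    qed
  qed
  then show ?thesis by (simp add: A_def)
qed

lemma one_minus_norm_le: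
  assumes "z \<in> unit_disc" "w \<in> unit_disc"
  shows "1 - cmod z \<le> cmod (1 - z * cnj w)" "1 - cmod w \<le> cmod (1 - z * cnj w)"
proof -
  have zw: "cmod z < 1" "cmod w < 1" using assms by auto
  have "1 - cmod z * cmod w \<le> cmod (1 - z * cnj w)"
    using norm_triangle_ineq2[of 1 "z * cnj w"] by (simp add: norm_mult)
  moreover have "cmod z * cmod w \<le> cmod z * 1" "cmod z * cmod w \<le> 1 * cmod w"
    using zw by (intro mult_left_mono mult_right_mono; simp)+
  ultimately show "1 - cmod z \<le> cmod (1 - z * cnj w)" "1 - cmod w \<le> cmod (1 - z * cnj w)"
    by auto
qed

lemma carleson_box_measurable [measurable]:
  "{w \<in> unit_disc. 1 - cmod w < x \<and> cmod (1 - z * cnj w) < y} \<in> sets disc_area"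
proof (rule sets_disc_area_borel)
  show "{w \<in> unit_disc. 1 - cmod w < x \<and> cmod (1 - z * cnj w) < y} \<in> sets borel" by measurable
qed blast

text \<open>
  The non-isotropic ball \<open>\<bar>1 - z cnj w\<bar> < y\<close> is contained in a disc of radius \<open>2 y\<close> about the radial
  projection \<open>u\<close> of \<open>z\<close> to the circle, so for small \<open>y\<close> the set is a box of sides comparable to \<open>x\<close>
  and \<open>y\<close> at \<open>u\<close>. For large \<open>y\<close> the area of the whole annulus is small enough.
\<close>

lemma carleson_box_area:
  assumes z: "z \<in> unit_disc" and x: "x > 0" and y: "y > 0"
  shows "emeasure disc_area {w \<in> unit_disc. 1 - cmod w < x \<and> cmod (1 - z * cnj w) < y} \<le> ennreal (40 * x * y)"
    (is "emeasure disc_area ?A \<le> _")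
proof (cases "y < 1 / 4")
  case False
  have "emeasure disc_area ?A \<le> emeasure disc_area {w \<in> unit_disc. 1 - cmod w < x}"
  proof (rule emeasure_mono)
    have "{w \<in> unit_disc. 1 - cmod w < x} \<in> sets borel" by measurable
    then show "{w \<in> unit_disc. 1 - cmod w < x} \<in> sets disc_area"
      by (rule sets_disc_area_borel) blast
  qed blast
  also have "\<dots> \<le> ennreal (2 * x)" by (rule emeasure_near_circle[OF x])
  also have "\<dots> \<le> ennreal (40 * x * y)"
    using False x mult_left_mono[of "1/4" y x] by (intro ennreal_leI) simp
  finally show ?thesis .
next
  case True
  show ?thesis
  proof (cases "?A = {}")
    case False
    then obtain w0 where "w0 \<in> ?A" by blast
    then have "1 - cmod z < y" using one_minus_norm_le(1)[OF z, of w0] by auto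
    then have z0: "z \<noteq> 0" using True by auto
    define u where "u = z / complex_of_real (cmod z)"
    have u: "cmod u = 1" using z0 by (simp add: u_def norm_divide)
    have zu: "z = complex_of_real (cmod z) * u" using z0 by (simp add: u_def)
    have sub: "cmod (w - u) < 2 * y" if w: "w \<in> ?A" for w
    proof -
      have "cmod (w - u) = cmod (1 - u * cnj w)"
      proof -
        have "u * cnj u = 1" using u by (metis complex_norm_square one_power2 of_real_1)
        then have "1 - u * cnj w = - (u * cnj (w - u))" by (simp add: algebra_simps)
        then show ?thesis using u by (metis complex_mod_cnj mult_1 norm_minus_cancel norm_mult)
      qed
      also have "\<dots> = cmod ((1 - z * cnj w) - complex_of_real (1 - cmod z) * (u * cnj w))"
      proof -
        have "1 - u * cnj w = (1 - complex_of_real (cmod z) * u * cnj w)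
            - complex_of_real (1 - cmod z) * (u * cnj w)"
          by (simp add: algebra_simps)
        then show ?thesis using zu by metis
      qed
      also have "\<dots> \<le> cmod (1 - z * cnj w) + (1 - cmod z) * cmod w"
      proof -
        have "cmod (complex_of_real (1 - cmod z) * (u * cnj w)) = (1 - cmod z) * cmod w"
          using z u by (simp only: norm_mult norm_of_real) simp
        then show ?thesis using norm_triangle_ineq4 by metis
      qed
      also have "\<dots> \<le> cmod (1 - z * cnj w) + (1 - cmod z) * 1"
        using w z by (intro add_left_mono mult_left_mono) auto
      also have "\<dots> \<le> cmod (1 - z * cnj w) + cmod (1 - z * cnj w)"
        using one_minus_norm_le(1)[OF z, of w] w by auto
      also have "\<dots> < 2 * y" using w by auto
      finally show ?thesis .
    qed
    have "emeasure disc_area ?A = ennreal (1 / pi) * emeasure lborel ?A"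
    proof (rule emeasure_disc_area_borel)
      show "?A \<in> sets borel" by measurable
    qed blast
    also have "\<dots> \<le> ennreal 1 * emeasure lborel ?A"
    proof (rule mult_right_mono)
      show "ennreal (1 / pi) \<le> ennreal 1" using pi_gt3 by (intro ennreal_leI) simp
    qed simp
    also have "\<dots> = emeasure lborel ?A" by simp
    also have "\<dots> \<le> emeasure lborel {w \<in> unit_disc. 1 - cmod w < x \<and> cmod (w - u) < 2 * y}"
    proof (rule emeasure_mono)
      show "?A \<subseteq> {w \<in> unit_disc. 1 - cmod w < x \<and> cmod (w - u) < 2 * y}" using sub by blast
      show "{w \<in> unit_disc. 1 - cmod w < x \<and> cmod (w - u) < 2 * y} \<in> sets lborel" by measurable
    qed
    also have "\<dots> \<le> ennreal (20 * x * (2 * y))"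
      using True x y by (intro carleson_box_near_point u) auto
    finally show ?thesis by (simp add: mult.assoc mult.left_commute)
  next
    case True
    then show ?thesis by (simp only: emeasure_empty zero_le)
  qed
qed

section \<open>Forelli--Rudin estimate\<close>

lemma term_le_suminf: "f j \<le> suminf f" for f :: "nat \<Rightarrow> ennreal"
  using sum_le_suminf[of f "{j}"] by simp

lemma nn_integral_le_geometric:
  fixes f :: "'a \<Rightarrow> ennreal" and g :: "nat \<Rightarrow> 'a \<Rightarrow> ennreal"
  assumes g: "\<And>i. g i \<in> borel_measurable M"
    and le: "\<And>x. x \<in> space M \<Longrightarrow> \<exists>i. f x \<le> g i x"
    and int: "\<And>i. (\<integral>\<^sup>+x. g i x \<partial>M) \<le> ennreal (A * \<rho> ^ i)"
    and \<rho>: "0 \<le> \<rho>" "\<rho> < 1" and A: "0 \<le> A"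
  shows "(\<integral>\<^sup>+x. f x \<partial>M) \<le> ennreal (A / (1 - \<rho>))"
proof -
  have "(\<integral>\<^sup>+x. f x \<partial>M) \<le> (\<integral>\<^sup>+x. (\<Sum>i. g i x) \<partial>M)"
  proof (rule nn_integral_mono)
    fix x assume "x \<in> space M"
    then obtain i where "f x \<le> g i x" using le by blast
    also have "g i x \<le> (\<Sum>i. g i x)" by (rule term_le_suminf)
    finally show "f x \<le> (\<Sum>i. g i x)" .
  qed
  also have "\<dots> = (\<Sum>i. \<integral>\<^sup>+x. g i x \<partial>M)"
    using g by (rule nn_integral_suminf)
  also have "\<dots> \<le> (\<Sum>i. ennreal (A * \<rho> ^ i))"
    by (intro suminf_le int) auto
  also have "\<dots> = ennreal (A * (1 / (1 - \<rho>)))"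
    using \<rho> A by (intro suminf_ennreal_eq sums_mult geometric_sums) auto
  finally show ?thesis by simp
qed

lemma dyadic_index:
  fixes x :: real
  assumes "x \<ge> 1"
  obtains j :: nat where "2 ^ j \<le> x" "x < 2 ^ Suc j"
proof -
  obtain n where n: "x < 2 ^ n" using real_arch_pow[of 2 x] by auto
  define m where "m = (LEAST n. x < 2 ^ n)"
  have m: "x < 2 ^ m" unfolding m_def using n by (rule LeastI)
  then have "m \<noteq> 0" using assms by (metis not_less power_0)
  then obtain j where j: "m = Suc j" by (cases m) auto
  have "\<not> x < 2 ^ j" using not_less_Least[of j "\<lambda>n. x < 2 ^ n"] j by (simp add: m_def)
  then show thesis using that[of j] m j by auto
qed

lemma power_powr: "0 < (c::real) \<Longrightarrow> (c ^ i) powr b = (c powr b) ^ i"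
  by (induction i) (auto simp: powr_mult)

lemma powr_comparable:
  fixes t v :: real
  assumes "0 < v" "v / 2 \<le> t" "t \<le> v"
  shows "t powr b \<le> 2 powr \<bar>b\<bar> * v powr b"
proof (cases "b \<ge> 0")
  case True
  have "t powr b \<le> v powr b" using assms True by (intro powr_mono2) auto
  also have "\<dots> \<le> 2 powr \<bar>b\<bar> * v powr b"
    using mult_right_mono[of 1 "2 powr \<bar>b\<bar>" "v powr b"] ge_one_powr_ge_zero[of 2 "\<bar>b\<bar>"] by simp
  finally show ?thesis .
next
  case False
  have "t powr b \<le> (v / 2) powr b" using assms False by (intro powr_mono2') auto
  also have "\<dots> = 2 powr \<bar>b\<bar> * v powr b"
    using assms False by (simp add: powr_divide powr_minus divide_simps)
  finally show ?thesis .
qed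

text \<open>
  Decompose by the size of \<open>1 - \<bar>w\<bar>\<close>, which is less than \<open>y\<close> on the domain of integration: the
  piece at height \<open>2\<^bsup>-i\<^esup> y\<close> has area of order \<open>2\<^bsup>-i\<^esup> y\<^sup>2\<close>, and the contributions are summable because
  \<open>1 + b > 0\<close>.
\<close>

lemma weighted_area_local:
  assumes z: "z \<in> unit_disc" and y: "y > 0" and b: "b > -1"
  shows "(\<integral>\<^sup>+w. ennreal ((1 - cmod w) powr b) * indicator {w. cmod (1 - z * cnj w) < y} w \<partial>disc_area)
    \<le> ennreal (80 * 2 powr \<bar>b\<bar> / (1 - 2 powr (- 1 - b)) * y powr (2 + b))"
proof -
  define \<rho> :: real where "\<rho> = 2 powr (- 1 - b)"
  define A where "A = 80 * 2 powr \<bar>b\<bar> * y powr (2 + b)"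
  have \<rho>: "0 \<le> \<rho>" "\<rho> < 1" using b by (auto simp: \<rho>_def intro: powr_less_one)
  define g :: "nat \<Rightarrow> complex \<Rightarrow> ennreal" where
    "g i = (\<lambda>w. ennreal (2 powr \<bar>b\<bar> * (y / 2 ^ i) powr b) *
      indicator {w \<in> unit_disc. 1 - cmod w < 2 * (y / 2 ^ i) \<and> cmod (1 - z * cnj w) < y} w)" for i
  have "(\<integral>\<^sup>+w. ennreal ((1 - cmod w) powr b) * indicator {w. cmod (1 - z * cnj w) < y} w \<partial>disc_area)
     \<le> ennreal (A / (1 - \<rho>))"
  proof (rule nn_integral_le_geometric[OF _ _ _ \<rho>])
    show "g i \<in> borel_measurable disc_area" for i
      unfolding g_def by measurable
    show "0 \<le> A" by (simp add: A_def)
    fix w assume "w \<in> space disc_area"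
    then have w: "w \<in> unit_disc" by simp
    show "\<exists>i. ennreal ((1 - cmod w) powr b) * indicator {w. cmod (1 - z * cnj w) < y} w \<le> g i w"
    proof (cases "cmod (1 - z * cnj w) < y")
      case True
      then have d: "0 < 1 - cmod w" "1 - cmod w < y"
        using w one_minus_norm_le(2)[OF z w] by auto
      then have "1 \<le> y / (1 - cmod w)" by simp
      then obtain j where "2 ^ j \<le> y / (1 - cmod w)" "y / (1 - cmod w) < 2 ^ Suc j"
        by (rule dyadic_index)
      then have j: "1 - cmod w \<le> y / 2 ^ j" "y / 2 ^ j / 2 < 1 - cmod w"
        using d by (auto simp: field_simps)
      have "(1 - cmod w) powr b \<le> 2 powr \<bar>b\<bar> * (y / 2 ^ j) powr b"
        using j y by (intro powr_comparable) auto
      moreover have "1 - cmod w < 2 * (y / 2 ^ j)" using j d by linarith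
      ultimately show ?thesis using w True
        by (intro exI[of _ j]) (auto simp: g_def intro: ennreal_leI)
    qed simp
  next
    fix i :: nat
    have "(\<integral>\<^sup>+w. g i w \<partial>disc_area) = ennreal (2 powr \<bar>b\<bar> * (y / 2 ^ i) powr b) *
        emeasure disc_area {w \<in> unit_disc. 1 - cmod w < 2 * (y / 2 ^ i) \<and> cmod (1 - z * cnj w) < y}"
      unfolding g_def by (rule nn_integral_cmult_indicator[OF carleson_box_measurable])
    also have "\<dots> \<le> ennreal (2 powr \<bar>b\<bar> * (y / 2 ^ i) powr b) * ennreal (40 * (2 * (y / 2 ^ i)) * y)"
      using y by (intro mult_left_mono carleson_box_area z) auto
    also have "\<dots> = ennreal (2 powr \<bar>b\<bar> * (y / 2 ^ i) powr b * (40 * (2 * (y / 2 ^ i)) * y))"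
      using y by (intro ennreal_mult[symmetric]) auto
    also have "2 powr \<bar>b\<bar> * (y / 2 ^ i) powr b * (40 * (2 * (y / 2 ^ i)) * y) = A * \<rho> ^ i"
    proof -
      have 1: "y powr (2 + b) = y\<^sup>2 * y powr b" using y by (simp add: powr_add)
      have "\<rho> = 1 / (2 * 2 powr b)"
        by (simp add: \<rho>_def powr_diff powr_minus field_simps)
      then have 2: "\<rho> ^ i = 1 / (2 ^ i * (2 powr b) ^ i)"
        by (simp add: power_mult_distrib power_one_over)
      have 3: "(y / 2 ^ i) powr b = y powr b / (2 powr b) ^ i"
        using y by (simp add: powr_divide power_powr)
      have alg: "K * (P / R) * (40 * (2 * (y / T)) * y) = 80 * K * (y\<^sup>2 * P) * (1 / (T * R))"
        for K P R T :: real
        by (simp add: power2_eq_square mult_ac)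
      show ?thesis
        unfolding A_def 1 2 3 by (rule alg)
    qed
    finally show "(\<integral>\<^sup>+w. g i w \<partial>disc_area) \<le> ennreal (A * \<rho> ^ i)" .
  qed
  then show ?thesis by (simp add: A_def \<rho>_def mult_ac)
qed

text \<open>
  With \<open>\<delta> = 1 - \<bar>z\<bar>\<close>, decompose by the size of \<open>\<bar>1 - z cnj w\<bar> \<ge> \<delta>\<close>: the piece at distance \<open>2\<^bsup>j\<^esup> \<delta>\<close>
  contributes \<open>(2\<^bsup>j\<^esup> \<delta>)\<^bsup>-c\<^esup>\<close>, and the sum over \<open>j\<close> converges because \<open>c > 0\<close>.
\<close>

lemma forelli_rudin:
  assumes b: "b > -1" and c: "c > 0"
  obtains C where "C > 0"
    "\<And>z. z \<in> unit_disc \<Longrightarrow>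
      (\<integral>\<^sup>+w. ennreal ((1 - cmod w) powr b / cmod (1 - z * cnj w) powr (2 + b + c)) \<partial>disc_area)
        \<le> ennreal (C * (1 - cmod z) powr (- c))"
proof -
  define C1 where "C1 = 80 * 2 powr \<bar>b\<bar> / (1 - 2 powr (- 1 - b))"
  define \<rho> :: real where "\<rho> = 2 powr (- c)"
  have \<rho>: "0 \<le> \<rho>" "\<rho> < 1" using c by (auto simp: \<rho>_def intro: powr_less_one)
  have C1: "C1 > 0" using powr_less_one[of 2 "- 1 - b"] b by (simp add: C1_def)
  show thesis
  proof (rule that[of "C1 * 2 powr (2 + b) / (1 - \<rho>)"])
    show "0 < C1 * 2 powr (2 + b) / (1 - \<rho>)" using C1 \<rho> by simp
    fix z assume z: "z \<in> unit_disc"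
    define \<delta> where "\<delta> = 1 - cmod z"
    have \<delta>: "\<delta> > 0" using z by (simp add: \<delta>_def)
    define A where "A = C1 * 2 powr (2 + b) * \<delta> powr (- c)"
    define g :: "nat \<Rightarrow> complex \<Rightarrow> ennreal" where
      "g j = (\<lambda>w. ennreal (1 / (2 ^ j * \<delta>) powr (2 + b + c)) * (ennreal ((1 - cmod w) powr b) *
        indicator {w. cmod (1 - z * cnj w) < 2 ^ Suc j * \<delta>} w))" for j
    have "(\<integral>\<^sup>+w. ennreal ((1 - cmod w) powr b / cmod (1 - z * cnj w) powr (2 + b + c)) \<partial>disc_area)
       \<le> ennreal (A / (1 - \<rho>))"
    proof (rule nn_integral_le_geometric[OF _ _ _ \<rho>])
      show "g j \<in> borel_measurable disc_area" for j
        unfolding g_def by measurable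
      show "0 \<le> A" using C1 by (simp add: A_def)
      fix w assume "w \<in> space disc_area"
      then have w: "w \<in> unit_disc" by simp
      have "1 \<le> cmod (1 - z * cnj w) / \<delta>"
        using one_minus_norm_le(1)[OF z w] \<delta> by (simp add: \<delta>_def)
      then obtain j where "2 ^ j \<le> cmod (1 - z * cnj w) / \<delta>" "cmod (1 - z * cnj w) / \<delta> < 2 ^ Suc j"
        by (rule dyadic_index)
      then have j: "2 ^ j * \<delta> \<le> cmod (1 - z * cnj w)" "cmod (1 - z * cnj w) < 2 ^ Suc j * \<delta>"
        using \<delta> by (auto simp: field_simps)
      have pos: "0 < 2 ^ j * \<delta>" using \<delta> by simp
      then have pos': "0 < cmod (1 - z * cnj w)" using j by linarith
      have "(1 - cmod w) powr b / cmod (1 - z * cnj w) powr (2 + b + c)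
          \<le> (1 - cmod w) powr b / (2 ^ j * \<delta>) powr (2 + b + c)"
        using j pos pos' b c \<delta> by (intro divide_left_mono powr_mono2 mult_pos_pos) (simp_all del: zero_less_mult_iff)
      also have "\<dots> = 1 / (2 ^ j * \<delta>) powr (2 + b + c) * (1 - cmod w) powr b" by simp
      finally show "\<exists>j. ennreal ((1 - cmod w) powr b / cmod (1 - z * cnj w) powr (2 + b + c)) \<le> g j w"
        using j by (intro exI[of _ j]) (simp add: g_def ennreal_mult[symmetric] ennreal_leI)
    next
      fix j :: nat
      have "(\<integral>\<^sup>+w. g j w \<partial>disc_area) = ennreal (1 / (2 ^ j * \<delta>) powr (2 + b + c)) *
          (\<integral>\<^sup>+w. ennreal ((1 - cmod w) powr b) *
            indicator {w. cmod (1 - z * cnj w) < 2 ^ Suc j * \<delta>} w \<partial>disc_area)"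
        unfolding g_def by (rule nn_integral_cmult) measurable
      also have "\<dots> \<le> ennreal (1 / (2 ^ j * \<delta>) powr (2 + b + c)) *
          ennreal (C1 * (2 ^ Suc j * \<delta>) powr (2 + b))"
        unfolding C1_def using \<delta> b by (intro mult_left_mono weighted_area_local z) auto
      also have "\<dots> = ennreal (1 / (2 ^ j * \<delta>) powr (2 + b + c) * (C1 * (2 ^ Suc j * \<delta>) powr (2 + b)))"
        using C1 by (intro ennreal_mult[symmetric]) auto
      also have "1 / (2 ^ j * \<delta>) powr (2 + b + c) * (C1 * (2 ^ Suc j * \<delta>) powr (2 + b)) = A * \<rho> ^ j"
      proof -
        have nz: "(2 ^ j * \<delta>) powr (2 + b) \<noteq> 0" using \<delta> by simp
        have 1: "(2 ^ Suc j * \<delta>) powr (2 + b) = 2 powr (2 + b) * (2 ^ j * \<delta>) powr (2 + b)"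
          using powr_mult[of 2 "2 ^ j * \<delta>" "2 + b"] \<delta> by (simp add: mult.assoc)
        have "(2 ^ j * \<delta>) powr c = (2 powr c) ^ j * \<delta> powr c"
          using \<delta> by (simp add: powr_mult power_powr)
        then have 2: "(2 ^ j * \<delta>) powr (2 + b + c) = (2 ^ j * \<delta>) powr (2 + b) * ((2 powr c) ^ j * \<delta> powr c)"
          by (simp add: powr_add)
        have 3: "\<rho> ^ j = 1 / (2 powr c) ^ j"
          by (simp add: \<rho>_def powr_minus power_inverse divide_inverse)
        have 4: "\<delta> powr (- c) = 1 / \<delta> powr c"
          by (simp add: powr_minus divide_inverse)
        have alg: "1 / (P * (R * D)) * (C1 * (K * P)) = C1 * K * (1 / D) * (1 / R)"
          if "P \<noteq> 0" for P R D K :: real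
          using that by simp
        show ?thesis
          unfolding A_def 1 2 3 4 by (rule alg[OF nz])
      qed
      finally show "(\<integral>\<^sup>+w. g j w \<partial>disc_area) \<le> ennreal (A * \<rho> ^ j)" .
    qed
    then show "(\<integral>\<^sup>+w. ennreal ((1 - cmod w) powr b / cmod (1 - z * cnj w) powr (2 + b + c)) \<partial>disc_area)
        \<le> ennreal (C1 * 2 powr (2 + b) / (1 - \<rho>) * (1 - cmod z) powr (- c))"
      by (simp add: A_def \<delta>_def)
  qed
qed

section \<open>The weighted kernel on the disc\<close>

definition disc_kernel :: "real \<Rightarrow> complex \<Rightarrow> complex \<Rightarrow> real" where
  "disc_kernel a z w = (1 - cmod z) powr a / cmod (1 - z * cnj w) powr (2 + a)"

text \<open>
  The values are extended reals, so that no integrability has to be known before the weak type bound.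
\<close>

definition disc_op :: "real \<Rightarrow> (complex \<Rightarrow> real) \<Rightarrow> complex \<Rightarrow> ennreal" where
  "disc_op a f z = (\<integral>\<^sup>+w. ennreal (disc_kernel a z w * f w) \<partial>disc_area)"

interpretation disc_pair: pair_sigma_finite disc_area disc_area
  by (intro pair_sigma_finite.intro disc_area.sigma_finite_measure_axioms)

lemma disc_kernel_nonneg [simp]: "0 \<le> disc_kernel a z w"
  by (simp add: disc_kernel_def)

lemma borel_measurable_disc_kernel [measurable (raw)]:
  assumes [measurable]: "f \<in> M \<rightarrow>\<^sub>M borel" "g \<in> M \<rightarrow>\<^sub>M borel"
  shows "(\<lambda>x. disc_kernel a (f x) (g x)) \<in> borel_measurable M"
  unfolding disc_kernel_def by measurable

lemma norm_one_minus_commute: "cmod (1 - z * cnj w) = cmod (1 - w * cnj z)"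
  by (metis complex_cnj_cnj complex_cnj_diff complex_cnj_mult complex_cnj_one complex_mod_cnj mult.commute)

text \<open>
  The kernel is homogeneous of degree \<open>-2\<close>, the degree that balances area; therefore a power of
  \<open>(1 - \<bar>w\<bar>) / (1 - \<bar>z\<bar>)\<close> can be inserted at no cost, in a range of exponents that
  depends on the variable of integration. These are the two halves of a Schur test.
\<close>

lemma disc_kernel_weight_source:
  assumes "-1 < s" "s < a" "a > 0"
  obtains C where "C > 0"
    "\<And>z. z \<in> unit_disc \<Longrightarrow>
      (\<integral>\<^sup>+w. ennreal (disc_kernel a z w * ((1 - cmod w) / (1 - cmod z)) powr s) \<partial>disc_area) \<le> ennreal C"
proof -
  obtain C where C: "C > 0"
    "\<And>z. z \<in> unit_disc \<Longrightarrow>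
      (\<integral>\<^sup>+w. ennreal ((1 - cmod w) powr s / cmod (1 - z * cnj w) powr (2 + s + (a - s))) \<partial>disc_area)
        \<le> ennreal (C * (1 - cmod z) powr (- (a - s)))"
    using forelli_rudin[of s "a - s"] assms by auto
  show thesis
  proof (rule that[OF C(1)])
    fix z assume z: "z \<in> unit_disc"
    have pos: "1 - cmod z > 0" using z by simp
    have "(\<integral>\<^sup>+w. ennreal (disc_kernel a z w * ((1 - cmod w) / (1 - cmod z)) powr s) \<partial>disc_area)
       = (\<integral>\<^sup>+w. ennreal ((1 - cmod z) powr (a - s)) *
           ennreal ((1 - cmod w) powr s / cmod (1 - z * cnj w) powr (2 + s + (a - s))) \<partial>disc_area)"
      using z by (intro nn_integral_cong)
        (simp add: ennreal_mult[symmetric] disc_kernel_def powr_divide powr_diff)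
    also have "\<dots> = ennreal ((1 - cmod z) powr (a - s)) *
        (\<integral>\<^sup>+w. ennreal ((1 - cmod w) powr s / cmod (1 - z * cnj w) powr (2 + s + (a - s))) \<partial>disc_area)"
      by (rule nn_integral_cmult) measurable
    also have "\<dots> \<le> ennreal ((1 - cmod z) powr (a - s)) * ennreal (C * (1 - cmod z) powr (- (a - s)))"
      by (intro mult_left_mono C(2) z) simp
    also have "\<dots> = ennreal ((1 - cmod z) powr (a - s) * (C * (1 - cmod z) powr (- (a - s))))"
      using C(1) by (intro ennreal_mult[symmetric]) auto
    also have "(1 - cmod z) powr (a - s) * (C * (1 - cmod z) powr (- (a - s)))
        = C * ((1 - cmod z) powr (a - s) * (1 - cmod z) powr (- (a - s)))"
      by (rule mult.left_commute)
    also have "\<dots> = C"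
      using pos by (simp only: powr_add[symmetric]) simp
    finally show "(\<integral>\<^sup>+w. ennreal (disc_kernel a z w * ((1 - cmod w) / (1 - cmod z)) powr s) \<partial>disc_area)
        \<le> ennreal C" .
  qed
qed

lemma disc_kernel_weight_target:
  assumes "0 < s" "s < 1 + a" "a > 0"
  obtains C where "C > 0"
    "\<And>w. w \<in> unit_disc \<Longrightarrow>
      (\<integral>\<^sup>+z. ennreal (disc_kernel a z w * ((1 - cmod w) / (1 - cmod z)) powr s) \<partial>disc_area) \<le> ennreal C"
proof -
  obtain C where C: "C > 0"
    "\<And>w. w \<in> unit_disc \<Longrightarrow>
      (\<integral>\<^sup>+z. ennreal ((1 - cmod z) powr (a - s) / cmod (1 - w * cnj z) powr (2 + (a - s) + s)) \<partial>disc_area)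
        \<le> ennreal (C * (1 - cmod w) powr (- s))"
    using forelli_rudin[of "a - s" s] assms by auto
  show thesis
  proof (rule that[OF C(1)])
    fix w assume w: "w \<in> unit_disc"
    have pos: "1 - cmod w > 0" using w by simp
    have "(\<integral>\<^sup>+z. ennreal (disc_kernel a z w * ((1 - cmod w) / (1 - cmod z)) powr s) \<partial>disc_area)
       = (\<integral>\<^sup>+z. ennreal ((1 - cmod w) powr s) *
           ennreal ((1 - cmod z) powr (a - s) / cmod (1 - w * cnj z) powr (2 + (a - s) + s)) \<partial>disc_area)"
      using w by (intro nn_integral_cong)
        (simp add: ennreal_mult[symmetric] disc_kernel_def powr_divide powr_diff norm_one_minus_commute[of w] mult.commute)
    also have "\<dots> = ennreal ((1 - cmod w) powr s) *
        (\<integral>\<^sup>+z. ennreal ((1 - cmod z) powr (a - s) / cmod (1 - w * cnj z) powr (2 + (a - s) + s)) \<partial>disc_area)"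
      by (rule nn_integral_cmult) measurable
    also have "\<dots> \<le> ennreal ((1 - cmod w) powr s) * ennreal (C * (1 - cmod w) powr (- s))"
      by (intro mult_left_mono C(2) w) simp
    also have "\<dots> = ennreal ((1 - cmod w) powr s * (C * (1 - cmod w) powr (- s)))"
      using C(1) by (intro ennreal_mult[symmetric]) auto
    also have "(1 - cmod w) powr s * (C * (1 - cmod w) powr (- s)) = C"
      using pos by (simp add: powr_minus)
    finally show "(\<integral>\<^sup>+z. ennreal (disc_kernel a z w * ((1 - cmod w) / (1 - cmod z)) powr s) \<partial>disc_area)
        \<le> ennreal C" .
  qed
qed

text \<open>
  If \<open>u\<close> exceeds the second term, then inserting \<open>M X\<^bsup>-\<beta>\<^esup> < u\<close> into \<open>u\<^bsup>p-1\<^esup>\<close> shows that the first term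
  is at least \<open>u\<close>.
\<close>

lemma weighted_young:
  fixes u M X p \<beta> :: real
  assumes "u \<ge> 0" "M > 0" "X > 0" "p > 1" "\<beta> > 0"
  shows "u \<le> M powr (1 - p) * u powr p * X powr ((p - 1) * \<beta>) + M * X powr (- \<beta>)"
proof (cases "u \<le> M * X powr (- \<beta>)")
  case True
  then show ?thesis by (simp add: add_increasing)
next
  case False
  then have less: "M * X powr (- \<beta>) < u" by simp
  have u: "u > 0" using less assms(2) by (metis le_less_trans mult_nonneg_nonneg less_imp_le powr_ge_zero)
  have "1 = M powr (1 - p) * (M * X powr (- \<beta>)) powr (p - 1) * X powr ((p - 1) * \<beta>)"
  proof -
    have "(M * X powr (- \<beta>)) powr (p - 1) = M powr (p - 1) * X powr (- ((p - 1) * \<beta>))"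
      using assms by (simp add: powr_mult powr_powr algebra_simps)
    then have "M powr (1 - p) * (M * X powr (- \<beta>)) powr (p - 1) * X powr ((p - 1) * \<beta>) =
       (M powr (1 - p) * M powr (p - 1)) * (X powr (- ((p - 1) * \<beta>)) * X powr ((p - 1) * \<beta>))"
      by (simp only: mult_ac)
    also have "\<dots> = 1" using assms by (simp only: powr_add[symmetric]) simp
    finally show ?thesis by simp
  qed
  also have "\<dots> \<le> M powr (1 - p) * u powr (p - 1) * X powr ((p - 1) * \<beta>)"
    using less assms by (intro mult_right_mono mult_left_mono powr_mono2) auto
  finally have "u * 1 \<le> u * (M powr (1 - p) * u powr (p - 1) * X powr ((p - 1) * \<beta>))"
    using u by (intro mult_left_mono) auto
  also have "\<dots> = M powr (1 - p) * (u * u powr (p - 1)) * X powr ((p - 1) * \<beta>)"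
    by (simp only: mult_ac)
  also have "u * u powr (p - 1) = u powr p"
    using u by (simp add: powr_diff)
  finally show ?thesis using assms by (simp add: add_increasing2)
qed

lemma borel_measurable_disc_op:
  assumes [measurable]: "f \<in> borel_measurable disc_area"
  shows "disc_op a f \<in> borel_measurable disc_area"
  unfolding disc_op_def by measurable

lemma disc_op_superlevel_sets:
  assumes f: "f \<in> borel_measurable disc_area"
  shows "{z \<in> unit_disc. disc_op a f z > ennreal s} \<in> sets disc_area"
proof -
  have [measurable]: "disc_op a f \<in> borel_measurable disc_area"
    by (rule borel_measurable_disc_op[OF f])
  have "{z \<in> space disc_area. disc_op a f z > ennreal s} \<in> sets disc_area" by measurable
  then show ?thesis by simp
qed

text \<open>
  The bound is stronger than plain weak type, as only the values of \<open>f\<close> above the height \<open>M\<close> enter.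
  This truncated form replaces real interpolation with \<open>L\<^bsup>\<infinity>\<^esup>\<close> in the passage to Lorentz spaces.
\<close>

lemma disc_op_weak_type:
  assumes a: "a > 0" and p: "p > 1"
  obtains C where "C > 0"
    "\<And>f M. f \<in> borel_measurable disc_area \<Longrightarrow> (\<And>w. 0 \<le> f w) \<Longrightarrow> M > 0 \<Longrightarrow>
      ennreal (M powr p) * emeasure disc_area {z \<in> unit_disc. disc_op a f z > ennreal (C * M)}
        \<le> (\<integral>\<^sup>+w. ennreal (f w powr p) * indicator {w. f w > M} w \<partial>disc_area)"
proof -
  \<comment> \<open>Any \<open>\<beta> > 0\<close> with \<open>\<beta> < 1\<close> and \<open>(p - 1) * \<beta> < 1 + a\<close> would do.\<close>
  define \<beta> where "\<beta> = 1 / (2 * p)"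
  define \<alpha> where "\<alpha> = (p - 1) * \<beta>"
  have \<beta>: "0 < \<beta>" "\<beta> < 1" and \<alpha>: "0 < \<alpha>" "\<alpha> < 1"
    using p by (auto simp: \<beta>_def \<alpha>_def field_simps)
  obtain C0 where C0: "C0 > 0" "\<And>z. z \<in> unit_disc \<Longrightarrow>
      (\<integral>\<^sup>+w. ennreal (disc_kernel a z w * ((1 - cmod w) / (1 - cmod z)) powr 0) \<partial>disc_area) \<le> ennreal C0"
    using disc_kernel_weight_source[of 0 a] a by auto
  obtain C1 where C1: "C1 > 0" "\<And>w. w \<in> unit_disc \<Longrightarrow>
      (\<integral>\<^sup>+z. ennreal (disc_kernel a z w * ((1 - cmod w) / (1 - cmod z)) powr \<alpha>) \<partial>disc_area) \<le> ennreal C1"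
    using disc_kernel_weight_target[of \<alpha> a] \<alpha> a by auto
  obtain C2 where C2: "C2 > 0" "\<And>z. z \<in> unit_disc \<Longrightarrow>
      (\<integral>\<^sup>+w. ennreal (disc_kernel a z w * ((1 - cmod w) / (1 - cmod z)) powr (- \<beta>)) \<partial>disc_area) \<le> ennreal C2"
    using disc_kernel_weight_source[of "- \<beta>" a] \<beta> a by auto
  define B where "B = max C1 C2"
  have B: "B > 0" "C1 \<le> B" "C2 \<le> B" using C1(1) by (auto simp: B_def)
  show thesis
  proof (rule that[of "C0 + 2 * B"])
    show "0 < C0 + 2 * B" using C0(1) B by simp
    fix f :: "complex \<Rightarrow> real" and M :: real
    assume f [measurable]: "f \<in> borel_measurable disc_area" and f0: "\<And>w. 0 \<le> f w" and M: "M > 0"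
    define g where "g = (\<lambda>w. f w * indicator {w. f w > M} w)"
    have g [measurable]: "g \<in> borel_measurable disc_area" unfolding g_def by measurable
    have g0: "0 \<le> g w" for w using f0 by (simp add: g_def)
    define F where "F = {z \<in> unit_disc. disc_op a g z > ennreal (2 * B * M)}"
    have F_meas [measurable]: "F \<in> sets disc_area"
      unfolding F_def by (rule disc_op_superlevel_sets[OF g])
    \<comment> \<open>The part of \<open>f\<close> below the height \<open>M\<close> contributes at most \<open>C0 * M\<close> everywhere.\<close>
    have split: "disc_op a f z \<le> ennreal (C0 * M) + disc_op a g z" if z: "z \<in> unit_disc" for z
    proof -
      have "disc_op a f z \<le> (\<integral>\<^sup>+w. ennreal (disc_kernel a z w) * ennreal M + ennreal (disc_kernel a z w * g w) \<partial>disc_area)"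
        unfolding disc_op_def
      proof (rule nn_integral_mono)
        fix w
        have "f w \<le> M + g w" using M by (auto simp: g_def indicator_def)
        then have "disc_kernel a z w * f w \<le> disc_kernel a z w * (M + g w)"
          by (intro mult_left_mono) auto
        then show "ennreal (disc_kernel a z w * f w) \<le>
            ennreal (disc_kernel a z w) * ennreal M + ennreal (disc_kernel a z w * g w)"
          using M g0 by (simp add: ennreal_mult[symmetric] ennreal_plus[symmetric] distrib_left ennreal_leI del: ennreal_plus)
      qed
      also have "\<dots> = (\<integral>\<^sup>+w. ennreal (disc_kernel a z w) * ennreal M \<partial>disc_area) + disc_op a g z"
        unfolding disc_op_def by (rule nn_integral_add) measurable
      also have "(\<integral>\<^sup>+w. ennreal (disc_kernel a z w) * ennreal M \<partial>disc_area)
          = (\<integral>\<^sup>+w. ennreal (disc_kernel a z w) \<partial>disc_area) * ennreal M"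
        by (rule nn_integral_multc) measurable
      also have "(\<integral>\<^sup>+w. ennreal (disc_kernel a z w) \<partial>disc_area) =
         (\<integral>\<^sup>+w. ennreal (disc_kernel a z w * ((1 - cmod w) / (1 - cmod z)) powr 0) \<partial>disc_area)"
        using z by (intro nn_integral_cong) auto
      also have "\<dots> \<le> ennreal C0" by (rule C0(2)[OF z])
      also have "ennreal C0 * ennreal M = ennreal (C0 * M)"
        using C0(1) M by (simp add: ennreal_mult)
      finally show ?thesis by (simp add: add_right_mono mult_right_mono)
    qed
    define I where "I = (\<integral>\<^sup>+w. ennreal (g w powr p) \<partial>disc_area)"
    let ?X = "\<lambda>z w. (1 - cmod w) / (1 - cmod z)"
    let ?u = "\<lambda>z w. ennreal (M powr (1 - p) * g w powr p) * ennreal (disc_kernel a z w * ?X z w powr \<alpha>)"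
    let ?v = "\<lambda>z w. ennreal M * ennreal (disc_kernel a z w * ?X z w powr (- \<beta>)) * indicator F z"
    \<comment> \<open>On \<open>F\<close> the operator exceeds \<open>2 * B * M\<close>, while the second Young term accounts for \<open>B * M\<close>
      only; so it can be absorbed in the left-hand side.\<close>
    have "ennreal (2 * B * M) * emeasure disc_area F = (\<integral>\<^sup>+z. ennreal (2 * B * M) * indicator F z \<partial>disc_area)"
      by (rule nn_integral_cmult_indicator[OF F_meas, symmetric])
    also have "\<dots> \<le> (\<integral>\<^sup>+z. (\<integral>\<^sup>+w. ?u z w \<partial>disc_area) + (\<integral>\<^sup>+w. ?v z w \<partial>disc_area) \<partial>disc_area)"
    proof (rule nn_integral_mono)
      fix z assume "z \<in> space disc_area"
      then have z: "z \<in> unit_disc" by simp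
      show "ennreal (2 * B * M) * indicator F z
          \<le> (\<integral>\<^sup>+w. ?u z w \<partial>disc_area) + (\<integral>\<^sup>+w. ?v z w \<partial>disc_area)"
      proof (cases "z \<in> F")
        case True
        then have "ennreal (2 * B * M) * indicator F z \<le> disc_op a g z" by (simp add: F_def less_imp_le)
        also have "\<dots> \<le> (\<integral>\<^sup>+w. ?u z w + ?v z w \<partial>disc_area)"
          unfolding disc_op_def
        proof (rule nn_integral_mono)
          fix w assume "w \<in> space disc_area"
          then have X: "?X z w > 0" using z by simp
          have "disc_kernel a z w * g w \<le> disc_kernel a z w *
              (M powr (1 - p) * g w powr p * ?X z w powr \<alpha> + M * ?X z w powr (- \<beta>))"
            unfolding \<alpha>_def by (intro mult_left_mono weighted_young g0 M X p \<beta>) simp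
          also have "\<dots> = (M powr (1 - p) * g w powr p) * (disc_kernel a z w * ?X z w powr \<alpha>)
              + M * (disc_kernel a z w * ?X z w powr (- \<beta>))"
            by (simp add: algebra_simps)
          finally have "ennreal (disc_kernel a z w * g w) \<le> ennreal \<dots>" by (rule ennreal_leI)
          also have "\<dots> = ?u z w + ?v z w"
            using True M by (simp add: ennreal_plus ennreal_mult[symmetric])
          finally show "ennreal (disc_kernel a z w * g w) \<le> ?u z w + ?v z w" .
        qed
        also have "\<dots> = (\<integral>\<^sup>+w. ?u z w \<partial>disc_area) + (\<integral>\<^sup>+w. ?v z w \<partial>disc_area)"
          by (rule nn_integral_add) measurable
        finally show ?thesis .
      qed simp
    qed
    also have "\<dots> = (\<integral>\<^sup>+z. (\<integral>\<^sup>+w. ?u z w \<partial>disc_area) \<partial>disc_area) + (\<integral>\<^sup>+z. (\<integral>\<^sup>+w. ?v z w \<partial>disc_area) \<partial>disc_area)"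
      by (rule nn_integral_add) measurable
    also have "(\<integral>\<^sup>+z. (\<integral>\<^sup>+w. ?u z w \<partial>disc_area) \<partial>disc_area) = (\<integral>\<^sup>+w. (\<integral>\<^sup>+z. ?u z w \<partial>disc_area) \<partial>disc_area)"
      by (rule disc_pair.Fubini'[symmetric]) measurable
    also have "\<dots> \<le> (\<integral>\<^sup>+w. ennreal (M powr (1 - p) * g w powr p) * ennreal B \<partial>disc_area)"
    proof (rule nn_integral_mono)
      fix w assume "w \<in> space disc_area"
      then have w: "w \<in> unit_disc" by simp
      have "(\<integral>\<^sup>+z. ?u z w \<partial>disc_area) = ennreal (M powr (1 - p) * g w powr p) *
          (\<integral>\<^sup>+z. ennreal (disc_kernel a z w * ?X z w powr \<alpha>) \<partial>disc_area)"
        by (rule nn_integral_cmult) measurable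
      also have "\<dots> \<le> ennreal (M powr (1 - p) * g w powr p) * ennreal B"
        using C1(2)[OF w] B by (intro mult_left_mono) (auto intro: order_trans ennreal_leI)
      finally show "(\<integral>\<^sup>+z. ?u z w \<partial>disc_area) \<le> ennreal (M powr (1 - p) * g w powr p) * ennreal B" .
    qed
    also have "\<dots> = ennreal (B * M powr (1 - p)) * I"
    proof -
      have "(\<integral>\<^sup>+w. ennreal (M powr (1 - p) * g w powr p) * ennreal B \<partial>disc_area)
         = (\<integral>\<^sup>+w. ennreal (B * M powr (1 - p)) * ennreal (g w powr p) \<partial>disc_area)"
        using B by (intro nn_integral_cong) (simp add: ennreal_mult[symmetric] mult_ac)
      also have "\<dots> = ennreal (B * M powr (1 - p)) * I"
        unfolding I_def by (rule nn_integral_cmult) measurable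
      finally show ?thesis .
    qed
    also have "(\<integral>\<^sup>+z. (\<integral>\<^sup>+w. ?v z w \<partial>disc_area) \<partial>disc_area) \<le> (\<integral>\<^sup>+z. ennreal (B * M) * indicator F z \<partial>disc_area)"
    proof (rule nn_integral_mono)
      fix z assume "z \<in> space disc_area"
      then have z: "z \<in> unit_disc" by simp
      have "(\<integral>\<^sup>+w. ?v z w \<partial>disc_area) = (\<integral>\<^sup>+w. ennreal M * ennreal (disc_kernel a z w * ?X z w powr (- \<beta>)) \<partial>disc_area) * indicator F z"
        by (rule nn_integral_multc) measurable
      also have "(\<integral>\<^sup>+w. ennreal M * ennreal (disc_kernel a z w * ?X z w powr (- \<beta>)) \<partial>disc_area)
          = ennreal M * (\<integral>\<^sup>+w. ennreal (disc_kernel a z w * ?X z w powr (- \<beta>)) \<partial>disc_area)"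
        by (rule nn_integral_cmult) measurable
      also have "\<dots> \<le> ennreal M * ennreal B"
        using C2(2)[OF z] B by (intro mult_left_mono) (auto intro: order_trans ennreal_leI)
      also have "\<dots> = ennreal (B * M)" using B M by (simp add: ennreal_mult[symmetric] mult.commute)
      finally show "(\<integral>\<^sup>+w. ?v z w \<partial>disc_area) \<le> ennreal (B * M) * indicator F z"
        by (simp add: mult_right_mono)
    qed
    also have "\<dots> = ennreal (B * M) * emeasure disc_area F"
      by (rule nn_integral_cmult_indicator[OF F_meas])
    finally have main: "ennreal (2 * B * M) * emeasure disc_area F
        \<le> ennreal (B * M powr (1 - p)) * I + ennreal (B * M) * emeasure disc_area F"
      by (simp add: add_mono)
    have "ennreal (M powr p) * emeasure disc_area F \<le> I"
    proof (cases I)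
      case (real i)
      have "2 * B * M * measure disc_area F \<le> B * M powr (1 - p) * i + B * M * measure disc_area F"
        using main B M real by (simp add: disc_area.emeasure_eq_measure ennreal_mult[symmetric]
          ennreal_plus[symmetric] del: ennreal_plus)
      then have "B * (M * measure disc_area F) \<le> B * (M powr (1 - p) * i)"
        by (simp add: algebra_simps)
      then have "M * measure disc_area F \<le> M powr (1 - p) * i" using B by simp
      then have "M powr (p - 1) * (M * measure disc_area F) \<le> M powr (p - 1) * (M powr (1 - p) * i)"
        by (intro mult_left_mono) auto
      moreover have "M powr (p - 1) * M = M powr p" using M by (simp add: powr_diff)
      moreover have "M powr (p - 1) * M powr (1 - p) = 1" using M by (simp add: powr_add[symmetric])
      ultimately have "M powr p * measure disc_area F \<le> i" by (simp add: mult.assoc[symmetric])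
      then show ?thesis using real
        by (simp add: disc_area.emeasure_eq_measure ennreal_mult[symmetric] ennreal_leI)
    qed simp
    moreover have "{z \<in> unit_disc. disc_op a f z > ennreal ((C0 + 2 * B) * M)} \<subseteq> F"
    proof
      fix z assume z: "z \<in> {z \<in> unit_disc. disc_op a f z > ennreal ((C0 + 2 * B) * M)}"
      have "ennreal (C0 * M) + ennreal (2 * B * M) = ennreal ((C0 + 2 * B) * M)"
        using C0(1) B M by (simp add: ennreal_plus[symmetric] distrib_right del: ennreal_plus)
      also have "\<dots> < ennreal (C0 * M) + disc_op a g z"
        using z split[of z] by (auto intro: less_le_trans)
      finally show "z \<in> F" using z by (auto simp: F_def)
    qed
    then have "emeasure disc_area {z \<in> unit_disc. disc_op a f z > ennreal ((C0 + 2 * B) * M)} \<le> emeasure disc_area F"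
      by (intro emeasure_mono F_meas)
    moreover have "I = (\<integral>\<^sup>+w. ennreal (f w powr p) * indicator {w. f w > M} w \<partial>disc_area)"
      unfolding I_def g_def by (intro nn_integral_cong) (auto simp: indicator_def)
    ultimately show "ennreal (M powr p) * emeasure disc_area {z \<in> unit_disc. disc_op a f z > ennreal ((C0 + 2 * B) * M)}
        \<le> (\<integral>\<^sup>+w. ennreal (f w powr p) * indicator {w. f w > M} w \<partial>disc_area)"
      by (metis (no_types, lifting) mult_left_mono order_trans zero_le)
  qed
qed

section \<open>Power-weighted integrals of distribution functions\<close>

text \<open>
  For \<open>\<theta> = r / p\<close> and \<open>D\<close> the distribution function of \<open>f\<close>, this is \<open>1 / p\<close> times the \<open>r\<close>-th power of the
  Lorentz quasi-norm of \<open>f\<close>.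
\<close>

definition layer_int :: "real \<Rightarrow> real \<Rightarrow> (real \<Rightarrow> real) \<Rightarrow> ennreal" where
  "layer_int r \<theta> D = (\<integral>\<^sup>+s\<in>{0<..}. ennreal (s powr (r - 1) * D s powr \<theta>) \<partial>lborel)"

lemma borel_measurable_antimono:
  fixes D :: "real \<Rightarrow> real"
  assumes "\<And>s t. s \<le> t \<Longrightarrow> D t \<le> D s"
  shows "D \<in> borel_measurable borel"
proof -
  have "(\<lambda>s. - D s) \<in> borel_measurable borel"
    using assms by (intro borel_measurable_mono) (auto simp: mono_def)
  then show ?thesis using borel_measurable_uminus_eq[of D] by simp
qed

lemma layer_int_scale:
  assumes k: "k > 0" and [measurable]: "D \<in> borel_measurable borel"
  shows "layer_int r \<theta> (\<lambda>s. D (k * s)) = ennreal (k powr (- r)) * layer_int r \<theta> D"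
proof -
  have "layer_int r \<theta> D = ennreal k * (\<integral>\<^sup>+s. ennreal ((k * s) powr (r - 1) * D (k * s) powr \<theta>) * indicator {0<..} (k * s) \<partial>lborel)"
    unfolding layer_int_def
    by (subst nn_integral_real_affine[where c = k and t = 0]) (use k in \<open>auto simp: abs_of_pos\<close>)
  also have "\<dots> = ennreal k * (\<integral>\<^sup>+s. ennreal (k powr (r - 1)) * (ennreal (s powr (r - 1) * D (k * s) powr \<theta>) * indicator {0<..} s) \<partial>lborel)"
  proof (rule arg_cong[where f = "\<lambda>x. ennreal k * x"], rule nn_integral_cong)
    fix s :: real
    show "ennreal ((k * s) powr (r - 1) * D (k * s) powr \<theta>) * indicator {0<..} (k * s)
        = ennreal (k powr (r - 1)) * (ennreal (s powr (r - 1) * D (k * s) powr \<theta>) * indicator {0<..} s)"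
    proof (cases "s > 0")
      case True
      then show ?thesis using k by (simp add: powr_mult ennreal_mult[symmetric] mult.assoc)
    next
      case False
      then show ?thesis using k by (simp add: zero_less_mult_iff)
    qed
  qed
  also have "\<dots> = ennreal k * (ennreal (k powr (r - 1)) * layer_int r \<theta> (\<lambda>s. D (k * s)))"
    unfolding layer_int_def by (subst nn_integral_cmult) auto
  also have "\<dots> = ennreal (k powr r) * layer_int r \<theta> (\<lambda>s. D (k * s))"
    using k by (simp add: mult.assoc[symmetric] ennreal_mult[symmetric] powr_diff)
  finally have "ennreal (k powr (- r)) * layer_int r \<theta> D
     = ennreal (k powr (- r) * k powr r) * layer_int r \<theta> (\<lambda>s. D (k * s))"
    by (simp add: mult.assoc[symmetric] ennreal_mult[symmetric])
  then show ?thesis using k by (simp add: powr_add[symmetric])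
qed

text \<open>
  A substitute for subadditivity of \<open>x \<mapsto> x\<^bsup>\<theta>\<^esup>\<close> that holds for all \<open>\<theta> > 0\<close>: at the cost of weights that grow
  geometrically as slowly as desired, every term is controlled by the whole sum on the right, and the resulting bounds
  \<open>2\<^bsup>-\<epsilon>j\<^esup>\<close> form a convergent series.
\<close>

lemma powr_le_suminf_powr:
  fixes d :: real and x :: "nat \<Rightarrow> real"
  assumes \<epsilon>: "\<epsilon> > 0" and \<theta>: "\<theta> > 0" and d: "d \<ge> 0" and x: "\<And>j. x j \<ge> 0"
    and le: "ennreal d \<le> (\<Sum>j. ennreal (x j))"
  shows "ennreal (d powr \<theta>) \<le> ennreal ((1 / (1 - 2 powr (- \<epsilon>))) powr \<theta>) *
    (\<Sum>j. ennreal ((2 powr (\<epsilon> * \<theta>)) ^ j * x j powr \<theta>))"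
proof (cases "\<Sum>j. ennreal ((2 powr (\<epsilon> * \<theta>)) ^ j * x j powr \<theta>)")
  case (real b)
  define \<rho> :: real where "\<rho> = 2 powr (- \<epsilon>)"
  have \<rho>: "0 < \<rho>" "\<rho> < 1" using \<epsilon> by (auto simp: \<rho>_def intro: powr_less_one)
  have x_le: "x j \<le> b powr (1 / \<theta>) * \<rho> ^ j" for j
  proof -
    have "ennreal ((2 powr (\<epsilon> * \<theta>)) ^ j * x j powr \<theta>)
        \<le> (\<Sum>i. ennreal ((2 powr (\<epsilon> * \<theta>)) ^ i * x i powr \<theta>))"
      by (rule term_le_suminf)
    then have "(2 powr (\<epsilon> * \<theta>)) ^ j * x j powr \<theta> \<le> b" using real by simp
    then have "((2 powr (\<epsilon> * \<theta>)) ^ j * x j powr \<theta>) powr (1 / \<theta>) \<le> b powr (1 / \<theta>)"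
      using \<theta> by (intro powr_mono2) auto
    moreover have "((2 powr (\<epsilon> * \<theta>)) ^ j * x j powr \<theta>) powr (1 / \<theta>) = (2 powr \<epsilon>) ^ j * x j"
    proof -
      have "((2 powr (\<epsilon> * \<theta>)) ^ j) powr (1 / \<theta>) = (2 powr \<epsilon>) ^ j"
        using \<theta> by (simp add: powr_realpow[symmetric] powr_powr)
      moreover have "(x j powr \<theta>) powr (1 / \<theta>) = x j"
        using \<theta> x[of j] by (simp add: powr_powr)
      ultimately show ?thesis by (simp add: powr_mult)
    qed
    ultimately have "(2 powr \<epsilon>) ^ j * x j \<le> b powr (1 / \<theta>)" by simp
    moreover have "\<rho> ^ j = 1 / (2 powr \<epsilon>) ^ j"
      by (simp add: \<rho>_def powr_minus power_inverse divide_inverse)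
    moreover have "(2 powr \<epsilon>) ^ j > (0::real)" by simp
    ultimately show ?thesis by (simp add: pos_le_divide_eq mult.commute)
  qed
  have "ennreal d \<le> (\<Sum>j. ennreal (b powr (1 / \<theta>) * \<rho> ^ j))"
    by (rule order_trans[OF le]) (intro suminf_le ennreal_leI x_le; simp)
  also have "\<dots> = ennreal (b powr (1 / \<theta>) * (1 / (1 - \<rho>)))"
    using \<rho> by (intro suminf_ennreal_eq sums_mult geometric_sums) auto
  finally have "d \<le> b powr (1 / \<theta>) * (1 / (1 - \<rho>))"
    using \<rho> by (subst (asm) ennreal_le_iff) auto
  then have "d powr \<theta> \<le> (b powr (1 / \<theta>) * (1 / (1 - \<rho>))) powr \<theta>"
    using d \<theta> by (intro powr_mono2) auto
  also have "\<dots> = (1 / (1 - \<rho>)) powr \<theta> * b"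
    using \<theta> \<rho> real by (subst powr_mult) (auto simp: powr_powr)
  finally have "ennreal (d powr \<theta>) \<le> ennreal ((1 / (1 - \<rho>)) powr \<theta>) * ennreal b"
    using real by (simp add: ennreal_mult[symmetric] ennreal_leI)
  then show ?thesis by (simp add: real \<rho>_def)
next
  case top
  have "2 powr (- \<epsilon>) < (1::real)" using \<epsilon> by (auto intro: powr_less_one)
  then have "0 < 1 - 2 powr (- \<epsilon>)" by linarith
  then have "0 < 1 / (1 - 2 powr (- \<epsilon>))" by (rule divide_pos_pos[OF zero_less_one])
  then have "(1 / (1 - 2 powr (- \<epsilon>))) powr \<theta> > (0::real)" by (metis less_irrefl powr_gt_zero)
  then show ?thesis unfolding top
    by (metis ennreal_mult_top ennreal_eq_0_iff not_less top_greatest)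
qed

text \<open>
  Rescaling the \<open>j\<close>-th dilate costs \<open>2\<^bsup>-jr\<^esup>\<close>, which beats the coefficient \<open>2\<^bsup>p0 j r/p\<^esup>\<close> exactly because
  \<open>p0 < p\<close>; half of the gap pays for the weights of \<open>powr_le_suminf_powr\<close>.
\<close>

lemma layer_int_hardy:
  assumes A: "A > 0" and K: "K > 0" and p: "0 < p0" "p0 < p" and r: "r > 0"
  obtains c where "c > 0"
    "\<And>D E. D \<in> borel_measurable borel \<Longrightarrow> E \<in> borel_measurable borel \<Longrightarrow>
      (\<And>s. 0 \<le> D s) \<Longrightarrow> (\<And>s. 0 \<le> E s) \<Longrightarrow>
      (\<And>M. M > 0 \<Longrightarrow> ennreal (E (K * M)) \<le> (\<Sum>j. ennreal (A * (2 powr p0) ^ j * D (2 ^ j * M)))) \<Longrightarrow>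
      layer_int r (r / p) E \<le> ennreal c * layer_int r (r / p) D"
proof -
  define \<theta> where "\<theta> = r / p"
  define \<epsilon> where "\<epsilon> = (p - p0) / 2"
  have \<theta>: "\<theta> > 0" and \<epsilon>: "\<epsilon> > 0" using p r by (auto simp: \<theta>_def \<epsilon>_def)
  define C where "C = (1 / (1 - 2 powr (- \<epsilon>))) powr \<theta>"
  define \<rho> :: real where "\<rho> = 2 powr ((\<epsilon> + p0) * \<theta> - r)"
  have "(\<epsilon> + p0) * \<theta> - r = - (r / p) * ((p - p0) / 2)"
    using p by (simp add: \<epsilon>_def \<theta>_def field_simps)
  also have "\<dots> < 0" using p r by (intro mult_neg_pos) auto
  finally have \<rho>: "0 < \<rho>" "\<rho> < 1" by (auto simp: \<rho>_def intro: powr_less_one)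
  have "2 powr (- \<epsilon>) < (1::real)" using \<epsilon> by (auto intro: powr_less_one)
  then have "0 < 1 - 2 powr (- \<epsilon>)" by linarith
  then have "0 < 1 / (1 - 2 powr (- \<epsilon>))" by (rule divide_pos_pos[OF zero_less_one])
  then have C: "C > 0" unfolding C_def by (metis less_irrefl powr_gt_zero)
  show thesis
  proof (rule that[of "K powr r * (C * (A powr \<theta> * (1 / (1 - \<rho>))))"])
    show "0 < K powr r * (C * (A powr \<theta> * (1 / (1 - \<rho>))))" using A K C \<rho> by simp
    fix D E :: "real \<Rightarrow> real"
    assume D [measurable]: "D \<in> borel_measurable borel" and E [measurable]: "E \<in> borel_measurable borel"
      and D0: "\<And>s. 0 \<le> D s" and E0: "\<And>s. 0 \<le> E s"
      and le: "\<And>M. M > 0 \<Longrightarrow> ennreal (E (K * M)) \<le> (\<Sum>j. ennreal (A * (2 powr p0) ^ j * D (2 ^ j * M)))"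
    let ?c = "\<lambda>j. A powr \<theta> * (2 powr ((\<epsilon> + p0) * \<theta>)) ^ j"
    have "layer_int r \<theta> (\<lambda>M. E (K * M)) \<le>
        (\<integral>\<^sup>+M. ennreal C * (\<Sum>j. ennreal (?c j) *
          (ennreal (M powr (r - 1) * D (2 ^ j * M) powr \<theta>) * indicator {0<..} M)) \<partial>lborel)"
      unfolding layer_int_def
    proof (rule nn_integral_mono)
      fix M :: real
      show "ennreal (M powr (r - 1) * E (K * M) powr \<theta>) * indicator {0<..} M \<le>
        ennreal C * (\<Sum>j. ennreal (?c j) *
          (ennreal (M powr (r - 1) * D (2 ^ j * M) powr \<theta>) * indicator {0<..} M))"
      proof (cases "M > 0")
        case True
        have "ennreal (E (K * M) powr \<theta>) \<le> ennreal C *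
            (\<Sum>j. ennreal ((2 powr (\<epsilon> * \<theta>)) ^ j * (A * (2 powr p0) ^ j * D (2 ^ j * M)) powr \<theta>))"
          unfolding C_def using A D0 E0
          by (intro powr_le_suminf_powr \<epsilon> \<theta> le True) auto
        also have "(\<lambda>j. (2 powr (\<epsilon> * \<theta>)) ^ j * (A * (2 powr p0) ^ j * D (2 ^ j * M)) powr \<theta>)
            = (\<lambda>j. ?c j * D (2 ^ j * M) powr \<theta>)"
        proof
          fix j
          have "((2 powr p0) ^ j) powr \<theta> = (2 powr (p0 * \<theta>)) ^ j"
            by (simp add: powr_realpow[symmetric] powr_powr mult_ac)
          then have "(A * (2 powr p0) ^ j * D (2 ^ j * M)) powr \<theta>
              = A powr \<theta> * (2 powr (p0 * \<theta>)) ^ j * D (2 ^ j * M) powr \<theta>"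
            using A D0 by (simp add: powr_mult)
          moreover have "(2 powr ((\<epsilon> + p0) * \<theta>)) ^ j = (2 powr (\<epsilon> * \<theta>)) ^ j * (2 powr (p0 * \<theta>)) ^ j"
            by (simp add: distrib_right powr_add power_mult_distrib)
          ultimately show "(2 powr (\<epsilon> * \<theta>)) ^ j * (A * (2 powr p0) ^ j * D (2 ^ j * M)) powr \<theta>
              = ?c j * D (2 ^ j * M) powr \<theta>"
            by (simp only: mult_ac)
        qed
        finally have "ennreal (M powr (r - 1)) * ennreal (E (K * M) powr \<theta>) \<le>
            ennreal (M powr (r - 1)) * (ennreal C * (\<Sum>j. ennreal (?c j * D (2 ^ j * M) powr \<theta>)))"
          by (intro mult_left_mono) auto
        also have "\<dots> = ennreal C * (\<Sum>j. ennreal (M powr (r - 1)) * ennreal (?c j * D (2 ^ j * M) powr \<theta>))"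
          by (simp add: mult.left_commute)
        also have "\<dots> = ennreal C * (\<Sum>j. ennreal (?c j) * (ennreal (M powr (r - 1) * D (2 ^ j * M) powr \<theta>)))"
          by (simp add: ennreal_mult[symmetric] mult_ac)
        finally show ?thesis using True by (simp add: ennreal_mult[symmetric])
      qed simp
    qed
    also have "\<dots> = ennreal C * (\<Sum>j. ennreal (?c j) * layer_int r \<theta> (\<lambda>M. D (2 ^ j * M)))"
      unfolding layer_int_def
      by (subst nn_integral_cmult, measurable, subst nn_integral_suminf, measurable, subst nn_integral_cmult) auto
    also have "\<dots> = ennreal C * (\<Sum>j. ennreal (A powr \<theta> * \<rho> ^ j) * layer_int r \<theta> D)"
    proof -
      have "ennreal (?c j) * layer_int r \<theta> (\<lambda>M. D (2 ^ j * M)) = ennreal (A powr \<theta> * \<rho> ^ j) * layer_int r \<theta> D" for j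
      proof -
        have "(2 powr ((\<epsilon> + p0) * \<theta>)) ^ j * (2 ^ j) powr (- r) = \<rho> ^ j"
        proof -
          have "(2 ^ j) powr (- r) = (2 powr (- r)) ^ j"
            by (simp add: powr_realpow[symmetric] powr_powr mult_ac)
          then show ?thesis by (simp add: \<rho>_def power_mult_distrib[symmetric] powr_add[symmetric])
        qed
        then have 1: "?c j * (2 ^ j) powr (- r) = A powr \<theta> * \<rho> ^ j" by (simp add: mult.assoc)
        have 2: "ennreal (?c j) * (ennreal ((2 ^ j) powr (- r)) * layer_int r \<theta> D)
            = ennreal (?c j * (2 ^ j) powr (- r)) * layer_int r \<theta> D"
          using A by (subst ennreal_mult[of "?c j"]) (auto simp: mult.assoc)
        have 3: "layer_int r \<theta> (\<lambda>M. D (2 ^ j * M)) = ennreal ((2 ^ j) powr (- r)) * layer_int r \<theta> D"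
          by (rule layer_int_scale) auto
        show ?thesis unfolding 2 3 1 by (rule refl)
      qed
      then show ?thesis by simp
    qed
    also have "\<dots> = ennreal C * ((\<Sum>j. ennreal (A powr \<theta> * \<rho> ^ j)) * layer_int r \<theta> D)"
      by simp
    also have "(\<Sum>j. ennreal (A powr \<theta> * \<rho> ^ j)) = ennreal (A powr \<theta> * (1 / (1 - \<rho>)))"
      using \<rho> by (intro suminf_ennreal_eq sums_mult geometric_sums) auto
    finally have *: "layer_int r \<theta> (\<lambda>M. E (K * M)) \<le>
        ennreal (C * (A powr \<theta> * (1 / (1 - \<rho>)))) * layer_int r \<theta> D"
      using C \<rho> by (simp add: ennreal_mult[symmetric] mult.assoc[symmetric])
    have "layer_int r \<theta> E = ennreal (K powr r) * layer_int r \<theta> (\<lambda>M. E (K * M))"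
      using K by (subst layer_int_scale[OF K E])
        (simp add: mult.assoc[symmetric] ennreal_mult[symmetric] powr_add[symmetric])
    also have "\<dots> \<le> ennreal (K powr r) * (ennreal (C * (A powr \<theta> * (1 / (1 - \<rho>)))) * layer_int r \<theta> D)"
      by (intro mult_left_mono *) simp
    also have "\<dots> = ennreal (K powr r * (C * (A powr \<theta> * (1 / (1 - \<rho>))))) * layer_int r \<theta> D"
      using C \<rho> by (subst ennreal_mult[of "K powr r"]) (auto simp: mult.assoc)
    finally show "layer_int r (r / p) E \<le> ennreal (K powr r * (C * (A powr \<theta> * (1 / (1 - \<rho>))))) * layer_int r (r / p) D"
      by (simp only: \<theta>_def)
  qed
qed

lemma nn_integral_powr_from_0:
  fixes \<kappa> x :: real
  assumes "\<kappa> > 0" "x \<ge> 0"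
  shows "(\<integral>\<^sup>+s. ennreal (s powr (\<kappa> - 1)) * indicator {0<..<x} s \<partial>lborel) = ennreal (x powr \<kappa> / \<kappa>)"
proof -
  have "((\<lambda>s. s powr (\<kappa> - 1)) has_integral (x powr \<kappa> / \<kappa>)) {0..x}"
    using has_integral_powr_from_0[of "\<kappa> - 1" x] assms by simp
  then have "((\<lambda>s. s powr (\<kappa> - 1)) has_integral (x powr \<kappa> / \<kappa>)) {0<..<x}"
    by (simp add: has_integral_Icc_iff_Ioo)
  then show ?thesis
    by (rule nn_integral_has_integral_lebesgue'[rotated]) (rule powr_ge_zero)
qed

lemma nn_integral_powr_to_inf:
  fixes \<kappa> x :: real
  assumes "\<kappa> > 0" "x > 0"
  shows "(\<integral>\<^sup>+s. ennreal (s powr (- \<kappa> - 1)) * indicator {x..} s \<partial>lborel) = ennreal (x powr (- \<kappa>) / \<kappa>)"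
proof -
  have "((\<lambda>s. s powr (- \<kappa> - 1)) has_integral (x powr (- \<kappa>) / \<kappa>)) {x..}"
    using has_integral_powr_to_inf[of "- \<kappa> - 1" x] assms by simp
  then show ?thesis
    by (rule nn_integral_has_integral_lebesgue'[rotated]) (rule powr_ge_zero)
qed

text \<open>
  A decreasing function is at least \<open>D s\<close> on \<open>(0, s)\<close>. This yields the embedding of Lorentz spaces in
  weak spaces.
\<close>

lemma layer_int_ge:
  assumes D: "\<And>s t. s \<le> t \<Longrightarrow> D t \<le> D s" "\<And>s. 0 \<le> D s" and r: "r > 0" "\<theta> > 0" and s: "s > 0"
  shows "ennreal (s powr r * D s powr \<theta> / r) \<le> layer_int r \<theta> D"
proof -
  have "ennreal (s powr r * D s powr \<theta> / r) = ennreal (D s powr \<theta>) * ennreal (s powr r / r)"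
    using r by (simp add: ennreal_mult[symmetric])
  also have "\<dots> = ennreal (D s powr \<theta>) * (\<integral>\<^sup>+t. ennreal (t powr (r - 1)) * indicator {0<..<s} t \<partial>lborel)"
    using r s by (subst nn_integral_powr_from_0) auto
  also have "\<dots> = (\<integral>\<^sup>+t. ennreal (D s powr \<theta>) * (ennreal (t powr (r - 1)) * indicator {0<..<s} t) \<partial>lborel)"
    by (rule nn_integral_cmult[symmetric]) measurable
  also have "\<dots> \<le> layer_int r \<theta> D"
    unfolding layer_int_def
  proof (rule nn_integral_mono)
    fix t :: real
    show "ennreal (D s powr \<theta>) * (ennreal (t powr (r - 1)) * indicator {0<..<s} t)
        \<le> ennreal (t powr (r - 1) * D t powr \<theta>) * indicator {0<..} t"
    proof (cases "t \<in> {0<..<s}")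
      case True
      then have "D s powr \<theta> \<le> D t powr \<theta>"
        using D r by (intro powr_mono2) auto
      then have "D s powr \<theta> * t powr (r - 1) \<le> t powr (r - 1) * D t powr \<theta>"
        by (simp add: mult.commute mult_right_mono)
      then show ?thesis using True by (simp add: ennreal_mult[symmetric] ennreal_leI)
    qed simp
  qed
  finally show ?thesis .
qed

text \<open>
  The two terms of the bound on \<open>g\<close> are monotone in opposite directions; \<open>m0\<close> is the point where they
  cross. At twice this point the increasing term dominates, which bounds \<open>g\<close>, and to the left of
  it the decreasing one does. Since \<open>D\<close> may jump, \<open>m0\<close> is defined as a supremum. The value
  \<open>m0 = 0\<close> covers the case without crossing, where \<open>g = 0\<close>.
\<close>

lemma distribution_crossing:
  fixes D :: "real \<Rightarrow> real"
  assumes D: "\<And>s t. s \<le> t \<Longrightarrow> D t \<le> D s" "\<And>s. 0 \<le> D s" "\<And>s. D s \<le> 1" and a: "a > 0" and B: "B \<ge> 0" and l: "l > 0"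
    and g: "g \<ge> 0" "\<And>m. m > 0 \<Longrightarrow> g \<le> D m + B * (m / l) powr (1 / a)"
  obtains m0 where "m0 \<ge> 0" "g \<le> (1 + B) * (2 * m0 / l) powr (1 / a)"
    "\<And>m. 0 < m \<Longrightarrow> m < m0 \<Longrightarrow> (m / l) powr (1 / a) \<le> D m"
proof -
  define N where "N = {m. 0 < m \<and> (m / l) powr (1 / a) < D m}"
  have N_less: "m \<le> l" if "m \<in> N" for m
  proof (rule ccontr)
    assume "\<not> m \<le> l"
    then have "1 \<le> (m / l) powr (1 / a)" using a l by (intro ge_one_powr_ge_zero) auto
    then show False using that D(3)[of m] by (auto simp: N_def)
  qed
  have bound: "g \<le> (1 + B) * (m / l) powr (1 / a)" if "m > 0" "m \<notin> N" for m
    using g(2)[OF that(1)] that by (auto simp: N_def distrib_right)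
  show thesis
  proof (cases "N = {}")
    case True
    have "((\<lambda>m. (1 + B) * (m / l) powr (1 / a)) \<longlongrightarrow> (1 + B) * (0 / l) powr (1 / a)) (at_right 0)"
      using a l by (intro tendsto_intros tendsto_powr2) (auto simp: eventually_at_right_less intro!: eventually_mono[OF eventually_at_right_less])
    then have "((\<lambda>m. (1 + B) * (m / l) powr (1 / a)) \<longlongrightarrow> 0) (at_right 0)" by simp
    moreover have "eventually (\<lambda>m. g \<le> (1 + B) * (m / l) powr (1 / a)) (at_right 0)"
      using eventually_at_right_less[of 0] by eventually_elim (use bound True in auto)
    ultimately have "g \<le> 0"
      by (rule tendsto_lowerbound) simp
    then show thesis using that[of 0] by simp
  next
    case False
    have bdd: "bdd_above N" using N_less by (auto simp: bdd_above_def)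
    define m0 where "m0 = Sup N"
    obtain m1 where m1: "m1 \<in> N" using False by auto
    then have "m1 \<le> m0" unfolding m0_def by (rule cSup_upper[OF _ bdd])
    then have m0: "m0 > 0" using m1 by (auto simp: N_def)
    have "2 * m0 \<notin> N"
    proof
      assume "2 * m0 \<in> N"
      then have "2 * m0 \<le> m0" unfolding m0_def by (rule cSup_upper[OF _ bdd])
      then show False using m0 by simp
    qed
    then have "g \<le> (1 + B) * (2 * m0 / l) powr (1 / a)" using m0 by (intro bound) auto
    moreover have "(m / l) powr (1 / a) \<le> D m" if m: "0 < m" "m < m0" for m
    proof -
      obtain m' where m': "m' \<in> N" "m < m'"
        using m(2) less_cSup_iff[OF False bdd] unfolding m0_def by auto
      have "(m / l) powr (1 / a) \<le> (m' / l) powr (1 / a)"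
        using m m' a l by (intro powr_mono2 divide_right_mono) auto
      also have "\<dots> \<le> D m'" using m' by (auto simp: N_def)
      also have "\<dots> \<le> D m" using m'(2) D(1) by auto
      finally show ?thesis .
    qed
    ultimately show thesis using that[of m0] m0 by auto
  qed
qed

text \<open>
  If \<open>D\<close> is the distribution function of \<open>g\<close> and \<open>h\<close> satisfies \<open>\<bar>{h > s}\<bar> \<le> B s\<^bsup>-1/a\<^esup>\<close>, then the
  distribution function \<open>G\<close> of \<open>g h\<close> satisfies the hypothesis, since \<open>g h > l\<close> forces \<open>g > m\<close> or
  \<open>h > l / m\<close>. For the proof, bound \<open>G l\<close> by a power of the crossing point \<open>m0\<close> and write this power as
  the integral of \<open>m\<^bsup>\<kappa>-1\<^esup>\<close> over \<open>(0, m0)\<close>. There \<open>(m / l)\<^bsup>1/a\<^esup> \<le> D m\<close>, that is \<open>l \<ge> m (D m)\<^bsup>-a\<^esup>\<close>, so after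
  exchanging the integrals the one over \<open>l\<close> is explicit, and the relation between \<open>p\<close>, \<open>q\<close> and \<open>a\<close> makes the
  exponents match.
\<close>

lemma layer_int_weak_multiplier:
  assumes a: "a > 0" and q: "q > 0" and pq: "1 / q = 1 / p + a" and p: "p > 0" and B: "B \<ge> 0" and r: "r > 0"
  obtains c where "c > 0"
    "\<And>D G. (\<And>s t. s \<le> t \<Longrightarrow> D t \<le> D s) \<Longrightarrow> (\<And>s. 0 \<le> D s) \<Longrightarrow> (\<And>s. D s \<le> 1) \<Longrightarrow> (\<And>l. 0 \<le> G l) \<Longrightarrow>
      (\<And>l m. l > 0 \<Longrightarrow> m > 0 \<Longrightarrow> G l \<le> D m + B * (m / l) powr (1 / a)) \<Longrightarrow>
      layer_int r (r / q) G \<le> ennreal c * layer_int r (r / p) D"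
proof -
  define \<theta> where "\<theta> = r / q"
  define \<kappa> where "\<kappa> = \<theta> / a"
  have \<theta>: "\<theta> > 0" using q r by (simp add: \<theta>_def)
  have \<kappa>: "\<kappa> > 0" using \<theta> a by (simp add: \<kappa>_def)
  have \<theta>p: "\<theta> = r / p + a * r"
    using arg_cong[OF pq, of "\<lambda>x. r * x"] by (simp add: \<theta>_def distrib_left mult.commute)
  have "\<kappa> - r = r / (p * a)"
    using a p by (simp add: \<kappa>_def \<theta>p field_simps)
  then have \<kappa>r: "\<kappa> - r > 0" using a p r by simp
  define c0 where "c0 = (1 + B) powr \<theta> * 2 powr \<kappa> * \<kappa>"
  have c0: "c0 > 0" using B \<kappa> by (simp add: c0_def add_nonneg_eq_0_iff)
  show thesis
  proof (rule that[of "c0 / (\<kappa> - r)"])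
    show "0 < c0 / (\<kappa> - r)" using c0 \<kappa>r by simp
    fix D G :: "real \<Rightarrow> real"
    assume D: "\<And>s t. s \<le> t \<Longrightarrow> D t \<le> D s" "\<And>s. 0 \<le> D s" "\<And>s. D s \<le> 1" and G0: "\<And>l. 0 \<le> G l"
      and le: "\<And>l m. l > 0 \<Longrightarrow> m > 0 \<Longrightarrow> G l \<le> D m + B * (m / l) powr (1 / a)"
    have D_meas [measurable]: "D \<in> borel_measurable borel"
      by (rule borel_measurable_antimono[OF D(1)])
    define R where "R = {(l, m). 0 < l \<and> 0 < m \<and> (m / l) powr (1 / a) \<le> D m}"
    have R_meas [measurable]: "R \<in> sets (lborel \<Otimes>\<^sub>M lborel)"
    proof -
      have "{x \<in> space (lborel \<Otimes>\<^sub>M lborel). 0 < fst x \<and> 0 < snd x \<and> (snd x / fst x) powr (1 / a) \<le> D (snd x)}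
          \<in> sets (lborel \<Otimes>\<^sub>M lborel)" by measurable
      also have "{x \<in> space (lborel \<Otimes>\<^sub>M lborel). 0 < fst x \<and> 0 < snd x \<and> (snd x / fst x) powr (1 / a) \<le> D (snd x)} = R"
        by (auto simp: R_def space_pair_measure)
      finally show ?thesis .
    qed
    let ?h = "\<lambda>l m. ennreal (l powr (r - 1 - \<kappa>)) * (ennreal (m powr (\<kappa> - 1)) * indicator R (l, m))"
    have "layer_int r \<theta> G \<le> (\<integral>\<^sup>+l. ennreal c0 * (\<integral>\<^sup>+m. ?h l m \<partial>lborel) \<partial>lborel)"
      unfolding layer_int_def
    proof (rule nn_integral_mono)
      fix l :: real
      show "ennreal (l powr (r - 1) * G l powr \<theta>) * indicator {0<..} l \<le> ennreal c0 * (\<integral>\<^sup>+m. ?h l m \<partial>lborel)"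
      proof (cases "l > 0")
        case True
        obtain m0 where m0: "m0 \<ge> 0" "G l \<le> (1 + B) * (2 * m0 / l) powr (1 / a)"
            "\<And>m. 0 < m \<Longrightarrow> m < m0 \<Longrightarrow> (m / l) powr (1 / a) \<le> D m"
          using distribution_crossing[OF D a B True G0[of l] le[OF True]] by blast
        have "G l powr \<theta> \<le> ((1 + B) * (2 * m0 / l) powr (1 / a)) powr \<theta>"
          using m0 G0 \<theta> by (intro powr_mono2) auto
        also have "\<dots> = (1 + B) powr \<theta> * (2 * m0 / l) powr \<kappa>"
          using B m0 True by (subst powr_mult) (auto simp: powr_powr \<kappa>_def)
        also have "(2 * m0 / l) powr \<kappa> = 2 powr \<kappa> * m0 powr \<kappa> * l powr (- \<kappa>)"
          using m0(1) True by (simp add: powr_divide powr_mult powr_minus_divide)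
        finally have "l powr (r - 1) * G l powr \<theta> \<le>
            l powr (r - 1) * ((1 + B) powr \<theta> * (2 powr \<kappa> * m0 powr \<kappa> * l powr (- \<kappa>)))"
          by (intro mult_left_mono) auto
        also have "\<dots> = c0 * ((l powr (r - 1) * l powr (- \<kappa>)) * (m0 powr \<kappa> / \<kappa>))"
          using \<kappa> by (simp add: c0_def)
        also have "l powr (r - 1) * l powr (- \<kappa>) = l powr (r - 1 - \<kappa>)"
          by (simp add: powr_add[symmetric])
        finally have "ennreal (l powr (r - 1) * G l powr \<theta>) \<le>
            ennreal (c0 * (l powr (r - 1 - \<kappa>) * (m0 powr \<kappa> / \<kappa>)))"
          by (rule ennreal_leI)
        also have "\<dots> = ennreal c0 * (ennreal (l powr (r - 1 - \<kappa>)) * ennreal (m0 powr \<kappa> / \<kappa>))"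
          using c0 \<kappa> by (simp add: ennreal_mult[symmetric])
        also have "ennreal (m0 powr \<kappa> / \<kappa>) = (\<integral>\<^sup>+m. ennreal (m powr (\<kappa> - 1)) * indicator {0<..<m0} m \<partial>lborel)"
          using \<kappa> m0 by (subst nn_integral_powr_from_0) auto
        also have "\<dots> \<le> (\<integral>\<^sup>+m. ennreal (m powr (\<kappa> - 1)) * indicator R (l, m) \<partial>lborel)"
          using m0(3) True by (intro nn_integral_mono) (auto simp: indicator_def R_def)
        also have "ennreal (l powr (r - 1 - \<kappa>)) * \<dots> = (\<integral>\<^sup>+m. ?h l m \<partial>lborel)"
          by (rule nn_integral_cmult[symmetric]) measurable
        finally show ?thesis using True by (simp add: mult_left_mono)
      qed simp
    qed
    also have "\<dots> = ennreal c0 * (\<integral>\<^sup>+l. (\<integral>\<^sup>+m. ?h l m \<partial>lborel) \<partial>lborel)"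
      by (rule nn_integral_cmult) measurable
    also have "(\<integral>\<^sup>+l. (\<integral>\<^sup>+m. ?h l m \<partial>lborel) \<partial>lborel) = (\<integral>\<^sup>+m. (\<integral>\<^sup>+l. ?h l m \<partial>lborel) \<partial>lborel)"
      by (rule lborel_pair.Fubini'[symmetric]) measurable
    also have "\<dots> \<le> (\<integral>\<^sup>+m. ennreal (1 / (\<kappa> - r)) * (ennreal (m powr (r - 1) * D m powr (r / p)) * indicator {0<..} m) \<partial>lborel)"
    proof (rule nn_integral_mono)
      fix m :: real
      show "(\<integral>\<^sup>+l. ?h l m \<partial>lborel) \<le> ennreal (1 / (\<kappa> - r)) * (ennreal (m powr (r - 1) * D m powr (r / p)) * indicator {0<..} m)"
      proof (cases "m > 0 \<and> D m > 0")
        case True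
        define l0 where "l0 = m * D m powr (- a)"
        have l0: "l0 > 0" using True by (simp add: l0_def)
        have "(\<integral>\<^sup>+l. ?h l m \<partial>lborel) \<le>
            (\<integral>\<^sup>+l. ennreal (m powr (\<kappa> - 1)) * (ennreal (l powr (- (\<kappa> - r) - 1)) * indicator {l0..} l) \<partial>lborel)"
        proof (rule nn_integral_mono)
          fix l :: real
          show "?h l m \<le> ennreal (m powr (\<kappa> - 1)) * (ennreal (l powr (- (\<kappa> - r) - 1)) * indicator {l0..} l)"
          proof (cases "(l, m) \<in> R")
            case R: True
            then have l: "l > 0" and "(m / l) powr (1 / a) \<le> D m" by (auto simp: R_def)
            then have "((m / l) powr (1 / a)) powr a \<le> D m powr a" using a by (intro powr_mono2) auto
            then have "m / l \<le> D m powr a" using a l True by (simp add: powr_powr)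
            then have "l0 \<le> l" using l True by (simp add: l0_def powr_minus field_simps)
            moreover have exp_eq: "r - 1 - \<kappa> = - (\<kappa> - r) - 1" by simp
            ultimately show ?thesis using R unfolding exp_eq by (simp add: mult.left_commute mult.commute)
          qed simp
        qed
        also have "\<dots> = ennreal (m powr (\<kappa> - 1)) * ennreal (l0 powr (- (\<kappa> - r)) / (\<kappa> - r))"
          using \<kappa>r l0 by (subst nn_integral_cmult) (auto simp: nn_integral_powr_to_inf simp del: minus_diff_eq)
        also have "\<dots> = ennreal (1 / (\<kappa> - r) * (m powr (\<kappa> - 1) * l0 powr (- (\<kappa> - r))))"
          using \<kappa>r by (simp add: ennreal_mult[symmetric] mult_ac)
        also have "m powr (\<kappa> - 1) * l0 powr (- (\<kappa> - r)) = m powr (r - 1) * D m powr (r / p)"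
        proof -
          have "l0 powr (- (\<kappa> - r)) = m powr (- (\<kappa> - r)) * (D m powr (- a)) powr (- (\<kappa> - r))"
            unfolding l0_def by (rule powr_mult)
          also have "(D m powr (- a)) powr (- (\<kappa> - r)) = D m powr (r / p)"
          proof -
            have "(- a) * (- (\<kappa> - r)) = r / p" using a by (simp add: \<kappa>_def \<theta>p field_simps)
            then show ?thesis by (simp only: powr_powr)
          qed
          finally have "m powr (\<kappa> - 1) * l0 powr (- (\<kappa> - r))
              = (m powr (\<kappa> - 1) * m powr (- (\<kappa> - r))) * D m powr (r / p)" by simp
          also have "m powr (\<kappa> - 1) * m powr (- (\<kappa> - r)) = m powr (r - 1)"
            by (simp add: powr_add[symmetric])
          finally show ?thesis .
        qed
        finally show ?thesis using True \<kappa>r by (simp add: ennreal_mult[symmetric])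
      next
        case False
        have "(l, m) \<notin> R" for l
        proof
          assume R: "(l, m) \<in> R"
          then have "0 < (m / l) powr (1 / a)" "(m / l) powr (1 / a) \<le> D m" by (auto simp: R_def)
          then have "0 < D m" by (rule less_le_trans)
          then show False using R False by (auto simp: R_def)
        qed
        then show ?thesis by simp
      qed
    qed
    also have "\<dots> = ennreal (1 / (\<kappa> - r)) * layer_int r (r / p) D"
      unfolding layer_int_def by (rule nn_integral_cmult) measurable
    finally show "layer_int r (r / q) G \<le> ennreal (c0 / (\<kappa> - r)) * layer_int r (r / p) D"
      using c0 \<kappa>r by (simp add: \<theta>_def mult_left_mono mult.assoc[symmetric] ennreal_mult[symmetric])
  qed
qed

section \<open>Lorentz quasi-norms and the boundedness of the operator\<close>

lemma superlevel_sets [measurable]: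
  assumes [measurable]: "f \<in> borel_measurable disc_area"
  shows "{z \<in> unit_disc. cmod (f z) > s} \<in> sets disc_area"
proof -
  have "{z \<in> space disc_area. cmod (f z) > s} \<in> sets disc_area" by measurable
  then show ?thesis by simp
qed

lemma distr_fun_mono:
  assumes "f \<in> borel_measurable disc_area" "s \<le> t"
  shows "distr_fun f t \<le> distr_fun f s"
  unfolding distr_fun_def
  using assms by (intro disc_area.finite_measure_mono superlevel_sets) auto

lemma distr_fun_nonneg [simp]: "0 \<le> distr_fun f s"
  by (simp add: distr_fun_def)

lemma lorentz_norm_conv_layer_int:
  "lorentz_norm p r f = epowr (ennreal p * layer_int r (r / p) (distr_fun f)) (1 / r)"
proof -
  have "(\<integral>\<^sup>+s\<in>{0<..}. ennreal (s powr r * distr_fun f s powr (r / p) / s) \<partial>lborel)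
      = layer_int r (r / p) (distr_fun f)"
    unfolding layer_int_def by (intro nn_integral_cong) (auto simp: indicator_def powr_diff)
  then show ?thesis by (simp add: lorentz_norm_def)
qed

lemma epowr_le:
  assumes le: "y \<le> ennreal c * x" and c: "c > 0" and \<alpha>: "\<alpha> > 0"
  shows "epowr y \<alpha> \<le> ennreal (c powr \<alpha>) * epowr x \<alpha>"
proof (cases x)
  case (real u)
  then have "y \<le> ennreal (c * u)" using le c by (simp add: ennreal_mult)
  then obtain v where v: "y = ennreal v" "0 \<le> v" "v \<le> c * u"
    using real c by (cases y) (auto simp: top_unique)
  have "v powr \<alpha> \<le> (c * u) powr \<alpha>" using v \<alpha> by (intro powr_mono2) auto
  also have "\<dots> = c powr \<alpha> * u powr \<alpha>" using c real by (simp add: powr_mult)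
  finally show ?thesis
    using v real by (simp add: epowr_def ennreal_mult[symmetric] ennreal_leI)
next
  case top
  have "c powr \<alpha> > 0" using c by simp
  then show ?thesis unfolding top epowr_def
    by (simp add: ennreal_mult_top)
qed

lemma epowr_less_top: "epowr x \<alpha> < \<infinity> \<longleftrightarrow> x < \<infinity>"
  by (simp add: epowr_def less_top)

text \<open>
  The layer cake formula: \<open>\<bar>f(z)\<bar>\<^bsup>p\<^esup>\<close> is the integral of \<open>p s\<^bsup>p-1\<^esup>\<close> over \<open>0 < s < \<bar>f(z)\<bar>\<close>.
\<close>

lemma nn_integral_powr_conv_layer_int:
  assumes p: "p > 0" and [measurable]: "f \<in> borel_measurable disc_area"
  shows "(\<integral>\<^sup>+z. ennreal (cmod (f z) powr p) \<partial>disc_area) = ennreal p * layer_int p 1 (distr_fun f)"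
proof -
  interpret Q: pair_sigma_finite "lborel :: real measure" disc_area
    by (intro pair_sigma_finite.intro disc_area.sigma_finite_measure_axioms lborel.sigma_finite_measure_axioms)
  let ?h = "\<lambda>s z. ennreal (s powr (p - 1)) * indicator {(s, z). 0 < s \<and> s < cmod (f z)} (s, z)"
  have h_meas: "(\<lambda>(s, z). ?h s z) \<in> borel_measurable (lborel \<Otimes>\<^sub>M disc_area)"
  proof -
    have [measurable]: "{x \<in> space (lborel \<Otimes>\<^sub>M disc_area). 0 < fst x \<and> fst x < cmod (f (snd x))}
        \<in> sets (lborel \<Otimes>\<^sub>M disc_area)"
      by measurable
    have "(\<lambda>x. ennreal (fst x powr (p - 1)) *
        indicator {x \<in> space (lborel \<Otimes>\<^sub>M disc_area). 0 < fst x \<and> fst x < cmod (f (snd x))} x)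
        \<in> borel_measurable (lborel \<Otimes>\<^sub>M disc_area)"
      by measurable
    also have "?this \<longleftrightarrow> ?thesis"
      by (intro measurable_cong) (auto simp: indicator_def)
    finally show ?thesis .
  qed
  have "layer_int p 1 (distr_fun f) = (\<integral>\<^sup>+s. (\<integral>\<^sup>+z. ?h s z \<partial>disc_area) \<partial>lborel)"
    unfolding layer_int_def
  proof (rule nn_integral_cong)
    fix s :: real
    show "ennreal (s powr (p - 1) * distr_fun f s powr 1) * indicator {0<..} s = (\<integral>\<^sup>+z. ?h s z \<partial>disc_area)"
    proof (cases "s > 0")
      case True
      have "(\<integral>\<^sup>+z. ?h s z \<partial>disc_area) =
          (\<integral>\<^sup>+z. ennreal (s powr (p - 1)) * indicator {z \<in> unit_disc. cmod (f z) > s} z \<partial>disc_area)"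
        using True by (intro nn_integral_cong) (auto simp: indicator_def)
      also have "\<dots> = ennreal (s powr (p - 1)) * emeasure disc_area {z \<in> unit_disc. cmod (f z) > s}"
        by (rule nn_integral_cmult_indicator) measurable
      also have "\<dots> = ennreal (s powr (p - 1) * distr_fun f s)"
        by (simp add: distr_fun_def disc_area.emeasure_eq_measure ennreal_mult)
      finally show ?thesis using True by simp
    qed simp
  qed
  also have "\<dots> = (\<integral>\<^sup>+z. (\<integral>\<^sup>+s. ?h s z \<partial>lborel) \<partial>disc_area)"
    by (rule Q.Fubini'[symmetric, OF h_meas])
  also have "\<dots> = (\<integral>\<^sup>+z. ennreal (1 / p) * ennreal (cmod (f z) powr p) \<partial>disc_area)"
  proof (rule nn_integral_cong)
    fix z
    have "(\<integral>\<^sup>+s. ?h s z \<partial>lborel) = (\<integral>\<^sup>+s. ennreal (s powr (p - 1)) * indicator {0<..<cmod (f z)} s \<partial>lborel)"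
      by (intro nn_integral_cong) (auto simp: indicator_def)
    also have "\<dots> = ennreal (cmod (f z) powr p / p)"
      by (rule nn_integral_powr_from_0) (use p in auto)
    also have "\<dots> = ennreal (1 / p) * ennreal (cmod (f z) powr p)"
      using p by (simp add: ennreal_mult[symmetric])
    finally show "(\<integral>\<^sup>+s. ?h s z \<partial>lborel) = ennreal (1 / p) * ennreal (cmod (f z) powr p)" .
  qed
  also have "\<dots> = ennreal (1 / p) * (\<integral>\<^sup>+z. ennreal (cmod (f z) powr p) \<partial>disc_area)"
    by (rule nn_integral_cmult) measurable
  finally show ?thesis
    using p by (simp add: mult.assoc[symmetric] ennreal_mult[symmetric])
qed

lemma Lp_norm_conv_lorentz_norm:
  assumes "p > 0" "f \<in> borel_measurable disc_area"
  shows "Lp_norm p f = lorentz_norm p p f"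
  using assms by (simp add: Lp_norm_def lorentz_norm_conv_layer_int nn_integral_powr_conv_layer_int)

lemma weak_norm_le_lorentz_norm:
  assumes q: "q > 0" and r: "r > 0" and f: "f \<in> borel_measurable disc_area"
  shows "weak_norm q f \<le> ennreal ((r / q) powr (1 / r)) * lorentz_norm q r f"
  unfolding weak_norm_def
proof (rule SUP_least)
  fix s :: real assume "s \<in> {0<..}"
  then have s: "s > 0" by simp
  have "ennreal (s powr r * distr_fun f s powr (r / q)) =
      ennreal r * ennreal (s powr r * distr_fun f s powr (r / q) / r)"
    using r by (simp add: ennreal_mult[symmetric])
  also have "\<dots> \<le> ennreal r * layer_int r (r / q) (distr_fun f)"
    using q r s f by (intro mult_left_mono layer_int_ge distr_fun_mono) auto
  also have "\<dots> = ennreal (r / q) * (ennreal q * layer_int r (r / q) (distr_fun f))"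
    using q r by (simp add: mult.assoc[symmetric] ennreal_mult[symmetric])
  finally have "epowr (ennreal (s powr r * distr_fun f s powr (r / q))) (1 / r)
      \<le> ennreal ((r / q) powr (1 / r)) * lorentz_norm q r f"
    unfolding lorentz_norm_conv_layer_int using q r by (intro epowr_le) auto
  also have "epowr (ennreal (s powr r * distr_fun f s powr (r / q))) (1 / r)
      = ennreal ((s powr r * distr_fun f s powr (r / q)) powr (1 / r))"
    by (simp add: epowr_def)
  also have "(s powr r * distr_fun f s powr (r / q)) powr (1 / r) = s * distr_fun f s powr (1 / q)"
    using r s by (simp add: powr_mult powr_powr)
  finally show "ennreal (s * distr_fun f s powr (1 / q)) \<le> ennreal ((r / q) powr (1 / r)) * lorentz_norm q r f" .
qed

lemma nn_integral_tail_le_dyadic: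
  assumes [measurable]: "f \<in> borel_measurable disc_area" and M: "M > 0" and p: "p > 0"
  shows "(\<integral>\<^sup>+w. ennreal (cmod (f w) powr p) * indicator {w. cmod (f w) > 2 * M} w \<partial>disc_area)
    \<le> (\<Sum>j. ennreal ((4 * M) powr p * (2 powr p) ^ j * distr_fun f (2 ^ j * M)))"
proof -
  let ?c = "\<lambda>j. (4 * M) powr p * (2 powr p) ^ j"
  let ?A = "\<lambda>j. {w \<in> unit_disc. cmod (f w) > 2 ^ j * M}"
  have "(\<integral>\<^sup>+w. ennreal (cmod (f w) powr p) * indicator {w. cmod (f w) > 2 * M} w \<partial>disc_area)
      \<le> (\<integral>\<^sup>+w. (\<Sum>j. ennreal (?c j) * indicator (?A j) w) \<partial>disc_area)"
  proof (rule nn_integral_mono)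
    fix w assume "w \<in> space disc_area"
    then have w: "w \<in> unit_disc" by simp
    show "ennreal (cmod (f w) powr p) * indicator {w. cmod (f w) > 2 * M} w
        \<le> (\<Sum>j. ennreal (?c j) * indicator (?A j) w)"
    proof (cases "cmod (f w) > 2 * M")
      case True
      then have "1 \<le> cmod (f w) / (2 * M)" using M by simp
      then obtain j where "2 ^ j \<le> cmod (f w) / (2 * M)" "cmod (f w) / (2 * M) < 2 ^ Suc j"
        by (rule dyadic_index)
      then have j: "2 * (2 ^ j * M) \<le> cmod (f w)" "cmod (f w) < 2 ^ j * (4 * M)"
        using M by (auto simp: field_simps)
      have "0 < 2 ^ j * M" using M by simp
      then have "2 ^ j * M < cmod (f w)" using j(1) by linarith
      then have wA: "w \<in> ?A j" using w by simp
      have "cmod (f w) powr p \<le> (2 ^ j * (4 * M)) powr p"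
        using j p by (intro powr_mono2) auto
      also have "\<dots> = ?c j" using M by (simp add: powr_mult power_powr)
      finally have "ennreal (cmod (f w) powr p) \<le> ennreal (?c j) * indicator (?A j) w"
        using wA by (simp add: ennreal_leI)
      also have "\<dots> \<le> (\<Sum>j. ennreal (?c j) * indicator (?A j) w)"
        by (rule term_le_suminf)
      finally show ?thesis using True by simp
    qed simp
  qed
  also have "\<dots> = (\<Sum>j. \<integral>\<^sup>+w. ennreal (?c j) * indicator (?A j) w \<partial>disc_area)"
    by (rule nn_integral_suminf) measurable
  also have "\<dots> = (\<Sum>j. ennreal (?c j * distr_fun f (2 ^ j * M)))"
  proof (rule arg_cong[where f = suminf], rule ext)
    fix j
    have "(\<integral>\<^sup>+w. ennreal (?c j) * indicator (?A j) w \<partial>disc_area) = ennreal (?c j) * emeasure disc_area (?A j)"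
      by (rule nn_integral_cmult_indicator[OF superlevel_sets]) measurable
    also have "\<dots> = ennreal (?c j * distr_fun f (2 ^ j * M))"
      by (simp add: distr_fun_def disc_area.emeasure_eq_measure ennreal_mult)
    finally show "(\<integral>\<^sup>+w. ennreal (?c j) * indicator (?A j) w \<partial>disc_area)
      = ennreal (?c j * distr_fun f (2 ^ j * M))" .
  qed
  finally show ?thesis .
qed

text \<open>
  The distribution function is \<open>O(s\<^bsup>-p\<^esup>)\<close>, which is integrable at infinity for \<open>p > 1\<close>, and the disc has
  finite area.
\<close>

lemma integrable_of_layer_int_finite:
  assumes f [measurable]: "f \<in> borel_measurable disc_area" and p: "p > 1" and r: "r > 0"
    and fin: "layer_int r (r / p) (distr_fun f) < \<infinity>"
  shows "integrable disc_area f"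
proof (rule integrableI_bounded[OF f])
  obtain L where L: "L \<ge> 0" "layer_int r (r / p) (distr_fun f) = ennreal L"
    using fin by (cases "layer_int r (r / p) (distr_fun f)") auto
  define B where "B = (r * L) powr (p / r)"
  have D_le: "distr_fun f s \<le> B * s powr (- p)" if s: "s > 0" for s
  proof -
    have "ennreal (s powr r * distr_fun f s powr (r / p) / r) \<le> ennreal L"
      unfolding L(2)[symmetric] using f p r s by (intro layer_int_ge distr_fun_mono) auto
    then have "s powr r * distr_fun f s powr (r / p) \<le> r * L"
      using L(1) r by (simp add: field_simps)
    then have "distr_fun f s powr (r / p) \<le> r * L * s powr (- r)"
      using s by (simp add: powr_minus field_simps)
    then have "(distr_fun f s powr (r / p)) powr (p / r) \<le> (r * L * s powr (- r)) powr (p / r)"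
      using p r by (intro powr_mono2) auto
    also have "\<dots> = B * s powr (- p)"
      using p r L(1) by (simp add: B_def powr_mult powr_powr)
    finally show ?thesis using p r by (simp add: powr_powr)
  qed
  define \<rho> :: real where "\<rho> = 2 powr (1 - p)"
  have \<rho>: "0 \<le> \<rho>" "\<rho> < 1" using p by (auto simp: \<rho>_def intro: powr_less_one)
  have "(\<integral>\<^sup>+w. ennreal (norm (f w)) \<partial>disc_area) \<le>
      (\<integral>\<^sup>+w. 2 + ennreal (cmod (f w) powr 1) * indicator {w. cmod (f w) > 2 * 1} w \<partial>disc_area)"
  proof (rule nn_integral_mono)
    fix w
    show "ennreal (norm (f w)) \<le> 2 + ennreal (cmod (f w) powr 1) * indicator {w. cmod (f w) > 2 * 1} w"
    proof (cases "cmod (f w) > 2")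
      case True
      then show ?thesis by (simp add: add_increasing)
    next
      case False
      then have "ennreal (cmod (f w)) \<le> ennreal 2" by (intro ennreal_leI) simp
      then show ?thesis using False by simp
    qed
  qed
  also have "\<dots> = 2 + (\<integral>\<^sup>+w. ennreal (cmod (f w) powr 1) * indicator {w. cmod (f w) > 2 * 1} w \<partial>disc_area)"
    using emeasure_disc_area_ball[of 1] by (subst nn_integral_add) auto
  also have "(\<integral>\<^sup>+w. ennreal (cmod (f w) powr 1) * indicator {w. cmod (f w) > 2 * 1} w \<partial>disc_area)
      \<le> (\<Sum>j. ennreal ((4 * 1) powr 1 * (2 powr 1) ^ j * distr_fun f (2 ^ j * 1)))"
    by (rule nn_integral_tail_le_dyadic) auto
  also have "\<dots> \<le> (\<Sum>j. ennreal (4 * B * \<rho> ^ j))"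
  proof (intro suminf_le ennreal_leI)
    fix j :: nat
    have "(2 ^ j) powr (- p) = (2 powr (- p)) ^ j" by (simp add: power_powr)
    moreover have "\<rho> ^ j = 2 ^ j * (2 powr (- p)) ^ j"
    proof -
      have "\<rho> = 2 * 2 powr (- p)" by (simp add: \<rho>_def powr_diff powr_minus_divide)
      then show ?thesis by (simp only: power_mult_distrib)
    qed
    moreover have "distr_fun f (2 ^ j) \<le> B * (2 ^ j) powr (- p)" by (rule D_le) simp
    ultimately have "2 ^ j * distr_fun f (2 ^ j) \<le> B * \<rho> ^ j"
      using mult_left_mono[of "distr_fun f (2 ^ j)" "B * (2 powr (- p)) ^ j" "2 ^ j"]
      by (simp only: mult.left_commute) simp
    then show "(4 * 1) powr 1 * (2 powr 1) ^ j * distr_fun f (2 ^ j * 1) \<le> 4 * B * \<rho> ^ j" by simp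
  qed auto
  also have "\<dots> = ennreal (4 * B * (1 / (1 - \<rho>)))"
    using \<rho> by (intro suminf_ennreal_eq sums_mult geometric_sums) (auto simp: B_def)
  finally have "(\<integral>\<^sup>+w. ennreal (norm (f w)) \<partial>disc_area) \<le> 2 + ennreal (4 * B * (1 / (1 - \<rho>)))"
    by (simp add: add_left_mono)
  also have "\<dots> < \<infinity>" by (simp add: less_top[symmetric])
  finally show "(\<integral>\<^sup>+w. ennreal (norm (f w)) \<partial>disc_area) < \<infinity>" .
qed

text \<open>
  This is the boundedness on \<open>L\<^bsup>p,r\<^esup>\<close> of the operator with the positive kernel: the dyadic form of the tail integral
  puts the weak type bound for an exponent between \<open>1\<close> and \<open>p\<close> into the shape that the Hardy type
  inequality requires.
\<close>

lemma disc_op_layer_int: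
  assumes a: "a > 0" and p: "p > 1" and r: "r > 0"
  obtains c where "c > 0"
    "\<And>f. f \<in> borel_measurable disc_area \<Longrightarrow>
      layer_int r (r / p) (\<lambda>s. measure disc_area {z \<in> unit_disc. disc_op a (\<lambda>w. cmod (f w)) z > ennreal s})
        \<le> ennreal c * layer_int r (r / p) (distr_fun f)"
proof -
  define p0 where "p0 = (1 + p) / 2"
  have p0: "1 < p0" "p0 < p" using p by (auto simp: p0_def)
  obtain C where C: "C > 0" "\<And>f M. f \<in> borel_measurable disc_area \<Longrightarrow> (\<And>w. 0 \<le> f w) \<Longrightarrow> M > 0 \<Longrightarrow>
      ennreal (M powr p0) * emeasure disc_area {z \<in> unit_disc. disc_op a f z > ennreal (C * M)}
        \<le> (\<integral>\<^sup>+w. ennreal (f w powr p0) * indicator {w. f w > M} w \<partial>disc_area)"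
    by (rule disc_op_weak_type[OF a p0(1)]) (rule that; blast)
  have pos: "0 < 2 powr p0" "0 < 2 * C" "0 < p0" using C(1) p0 by auto
  obtain c where c: "c > 0" "\<And>D E. D \<in> borel_measurable borel \<Longrightarrow> E \<in> borel_measurable borel \<Longrightarrow>
      (\<And>s. 0 \<le> D s) \<Longrightarrow> (\<And>s. 0 \<le> E s) \<Longrightarrow>
      (\<And>M. M > 0 \<Longrightarrow> ennreal (E ((2 * C) * M)) \<le> (\<Sum>j. ennreal (2 powr p0 * (2 powr p0) ^ j * D (2 ^ j * M)))) \<Longrightarrow>
      layer_int r (r / p) E \<le> ennreal c * layer_int r (r / p) D"
    by (rule layer_int_hardy[OF pos p0(2) r]) (rule that; blast)
  show thesis
  proof (rule that[OF c(1)])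
    fix f :: "complex \<Rightarrow> complex" assume f [measurable]: "f \<in> borel_measurable disc_area"
    define E where "E = (\<lambda>s. measure disc_area {z \<in> unit_disc. disc_op a (\<lambda>w. cmod (f w)) z > ennreal s})"
    have sets: "{z \<in> unit_disc. disc_op a (\<lambda>w. cmod (f w)) z > ennreal s} \<in> sets disc_area" for s
      by (rule disc_op_superlevel_sets) measurable
    have E_mono: "E t \<le> E s" if "s \<le> t" for s t
      unfolding E_def using that
      by (intro disc_area.finite_measure_mono sets) (auto intro: le_less_trans[OF ennreal_leI])
    have "layer_int r (r / p) E \<le> ennreal c * layer_int r (r / p) (distr_fun f)"
    proof (rule c(2))
      show "distr_fun f \<in> borel_measurable borel"
        by (intro borel_measurable_antimono distr_fun_mono f)
      show "E \<in> borel_measurable borel"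
        by (intro borel_measurable_antimono E_mono)
      show "0 \<le> E s" for s by (simp add: E_def)
      fix M :: real assume M: "M > 0"
      define x where "x = (2 * M) powr p0"
      have x: "x > 0" using M by (simp add: x_def)
      have "ennreal x * ennreal (E (2 * C * M)) \<le>
          (\<integral>\<^sup>+w. ennreal (cmod (f w) powr p0) * indicator {w. cmod (f w) > 2 * M} w \<partial>disc_area)"
        using C(2)[of "\<lambda>w. cmod (f w)" "2 * M"] M
        by (simp add: x_def E_def disc_area.emeasure_eq_measure mult_ac)
      also have "\<dots> \<le> (\<Sum>j. ennreal ((4 * M) powr p0 * (2 powr p0) ^ j * distr_fun f (2 ^ j * M)))"
        using M p0 by (intro nn_integral_tail_le_dyadic f) auto
      also have "(\<lambda>j. (4 * M) powr p0 * (2 powr p0) ^ j * distr_fun f (2 ^ j * M))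
          = (\<lambda>j. x * (2 powr p0 * (2 powr p0) ^ j * distr_fun f (2 ^ j * M)))"
      proof -
        have "(4 * M) powr p0 = x * 2 powr p0"
          using M by (simp add: x_def powr_mult[symmetric])
        then show ?thesis by (simp add: mult.assoc)
      qed
      also have "(\<Sum>j. ennreal (x * (2 powr p0 * (2 powr p0) ^ j * distr_fun f (2 ^ j * M))))
          = ennreal x * (\<Sum>j. ennreal (2 powr p0 * (2 powr p0) ^ j * distr_fun f (2 ^ j * M)))"
        using x by (subst ennreal_mult) (auto simp: ennreal_suminf_cmult)
      finally have *: "ennreal (1 / x) * (ennreal x * ennreal (E (2 * C * M))) \<le>
          ennreal (1 / x) * (ennreal x * (\<Sum>j. ennreal (2 powr p0 * (2 powr p0) ^ j * distr_fun f (2 ^ j * M))))"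
        by (rule mult_left_mono) simp
      show "ennreal (E (2 * C * M)) \<le> (\<Sum>j. ennreal (2 powr p0 * (2 powr p0) ^ j * distr_fun f (2 ^ j * M)))"
      proof -
        have "ennreal (1 / x) * ennreal x = 1" using x by (simp add: ennreal_mult[symmetric])
        then show ?thesis using * by (simp only: mult.assoc[symmetric] mult_1)
      qed
    qed auto
    then show "layer_int r (r / p) (\<lambda>s. measure disc_area {z \<in> unit_disc. disc_op a (\<lambda>w. cmod (f w)) z > ennreal s})
        \<le> ennreal c * layer_int r (r / p) (distr_fun f)" by (simp add: E_def)
  qed
qed

lemma Re_one_minus_pos:
  assumes "z \<in> unit_disc" "w \<in> unit_disc"
  shows "0 < Re (1 - z * cnj w)"
proof -
  have "cmod z * cmod w < 1 * 1"
    using assms by (intro mult_strict_mono') auto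
  then have "cmod (z * cnj w) < 1" by (simp add: norm_mult)
  then show ?thesis using complex_Re_le_cmod[of "z * cnj w"] by simp
qed

text \<open>
  The principal power is continuous on the right half-plane, in which \<open>1 - z cnj w\<close> lies; elsewhere the
  kernel is replaced by \<open>0\<close> to obtain a Borel function of all pairs.
\<close>

lemma borel_measurable_K_integrand_pair:
  assumes f [measurable]: "f \<in> borel_measurable disc_area"
  shows "(\<lambda>(z, w). K_integrand a f z w) \<in> borel_measurable (disc_area \<Otimes>\<^sub>M disc_area)"
proof -
  let ?k = "\<lambda>x. 1 / (1 - fst x * cnj (snd x)) powr complex_of_real a"
  define H where "H = (\<lambda>x. if x \<in> unit_disc \<times> unit_disc then ?k x else 0)"
  have pos: "0 < Re (1 - fst x * cnj (snd x))" if "x \<in> unit_disc \<times> unit_disc" for x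
    using that by (intro Re_one_minus_pos) auto
  have "continuous_on (unit_disc \<times> unit_disc)
      (\<lambda>x. 1 / exp (complex_of_real a * Ln (1 - fst x * cnj (snd x))))"
  proof (intro continuous_intros ballI)
    fix x :: "complex \<times> complex" assume "x \<in> unit_disc \<times> unit_disc"
    from pos[OF this] show "1 - fst x * cnj (snd x) \<notin> \<real>\<^sub>\<le>\<^sub>0"
      unfolding complex_nonpos_Reals_iff by linarith
  qed simp
  also have "?this \<longleftrightarrow> continuous_on (unit_disc \<times> unit_disc) ?k"
  proof (intro continuous_on_cong refl)
    fix x :: "complex \<times> complex" assume "x \<in> unit_disc \<times> unit_disc"
    from pos[OF this] have "1 - fst x * cnj (snd x) \<noteq> 0" by (metis less_irrefl zero_complex.sel(1))
    then show "1 / exp (complex_of_real a * Ln (1 - fst x * cnj (snd x))) = ?k x"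
      by (simp only: powr_def if_False)
  qed
  finally have "continuous_on (unit_disc \<times> unit_disc) ?k" .
  then have [measurable]: "H \<in> borel_measurable borel"
    unfolding H_def by (intro borel_measurable_continuous_on_if) (auto intro!: borel_open open_Times)
  have "(\<lambda>x. f (snd x) * H (fst x, snd x)) \<in> borel_measurable (disc_area \<Otimes>\<^sub>M disc_area)"
    by measurable
  also have "?this \<longleftrightarrow> ?thesis"
    by (intro measurable_cong) (auto simp: H_def K_integrand_def space_pair_measure)
  finally show ?thesis .
qed

lemma borel_measurable_K_integrand:
  assumes "f \<in> borel_measurable disc_area" "z \<in> unit_disc"
  shows "K_integrand a f z \<in> borel_measurable disc_area"
  using measurable_compose[OF measurable_Pair1' borel_measurable_K_integrand_pair[OF assms(1), of a], of z] assms(2)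
  by simp

lemma borel_measurable_K_op:
  assumes "f \<in> borel_measurable disc_area"
  shows "K_op a f \<in> borel_measurable disc_area"
  unfolding K_op_def[abs_def]
  by (intro disc_area.borel_measurable_lebesgue_integral borel_measurable_K_integrand_pair assms)

lemma norm_K_integrand:
  assumes "z \<in> unit_disc"
  shows "norm (K_integrand (2 + a) f z w) = (1 - cmod z) powr (- a) * (disc_kernel a z w * cmod (f w))"
proof -
  have "1 - cmod z > 0" using assms by simp
  then have "(1 - cmod z) powr (- a) * (1 - cmod z) powr a = 1"
    by (simp add: powr_add[symmetric])
  then show ?thesis
    by (simp add: K_integrand_def norm_divide norm_powr_real_powr' disc_kernel_def field_simps)
qed

lemma integrable_K_integrand:
  assumes f: "integrable disc_area f" and z: "z \<in> unit_disc" and a: "a \<ge> 0"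
  shows "integrable disc_area (K_integrand a f z)"
proof (rule Bochner_Integration.integrable_bound)
  show "integrable disc_area (\<lambda>w. complex_of_real ((1 - cmod z) powr (- a)) * f w)"
    using f by simp
  show "K_integrand a f z \<in> borel_measurable disc_area"
    using f z by (intro borel_measurable_K_integrand) auto
  show "AE w in disc_area. norm (K_integrand a f z w) \<le> norm (complex_of_real ((1 - cmod z) powr (- a)) * f w)"
  proof (rule AE_I2)
    fix w assume "w \<in> space disc_area"
    then have w: "w \<in> unit_disc" by simp
    have "(1 - cmod z) powr a \<le> cmod (1 - z * cnj w) powr a"
      using one_minus_norm_le(1)[OF z w] z a by (intro powr_mono2) auto
    moreover have "(1 - cmod z) powr a > 0" using z by simp
    ultimately have "cmod (f w) / cmod (1 - z * cnj w) powr a \<le> cmod (f w) / (1 - cmod z) powr a"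
      by (intro divide_left_mono mult_pos_pos) auto
    moreover have "norm (K_integrand a f z w) = cmod (f w) / cmod (1 - z * cnj w) powr a"
      by (simp add: K_integrand_def norm_divide norm_powr_real_powr')
    moreover have "norm (complex_of_real ((1 - cmod z) powr (- a)) * f w) = cmod (f w) / (1 - cmod z) powr a"
      by (simp only: norm_mult norm_of_real powr_minus_divide) simp
    ultimately show "norm (K_integrand a f z w) \<le> norm (complex_of_real ((1 - cmod z) powr (- a)) * f w)"
      by simp
  qed
qed

lemma norm_K_op_le:
  assumes f [measurable]: "f \<in> borel_measurable disc_area" and z: "z \<in> unit_disc"
  shows "ennreal (cmod (K_op (2 + a) f z)) \<le> ennreal ((1 - cmod z) powr (- a)) * disc_op a (\<lambda>w. cmod (f w)) z"
proof (cases "integrable disc_area (K_integrand (2 + a) f z)")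
  case True
  have "ennreal (cmod (K_op (2 + a) f z)) \<le> (\<integral>\<^sup>+w. ennreal (norm (K_integrand (2 + a) f z w)) \<partial>disc_area)"
    unfolding K_op_def using True by (rule integral_norm_bound_ennreal)
  also have "\<dots> = (\<integral>\<^sup>+w. ennreal ((1 - cmod z) powr (- a)) * ennreal (disc_kernel a z w * cmod (f w)) \<partial>disc_area)"
    by (intro nn_integral_cong) (simp only: norm_K_integrand[OF z], simp add: ennreal_mult)
  also have "\<dots> = ennreal ((1 - cmod z) powr (- a)) * disc_op a (\<lambda>w. cmod (f w)) z"
    unfolding disc_op_def by (rule nn_integral_cmult) measurable
  finally show ?thesis .
next
  case False
  then show ?thesis by (simp add: K_op_def not_integrable_integral_eq)
qed

text \<open>
  A product exceeds \<open>l\<close> only if one factor exceeds \<open>m\<close> or the other exceeds \<open>l / m\<close>; for the factor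
  \<open>(1 - \<bar>z\<bar>)\<^bsup>-a\<^esup>\<close> the latter describes an annulus at the circle.
\<close>

lemma distr_fun_K_op_le:
  assumes f [measurable]: "f \<in> borel_measurable disc_area" and a: "a > 0" and l: "l > 0" and m: "m > 0"
  shows "distr_fun (K_op (2 + a) f) l \<le>
    measure disc_area {z \<in> unit_disc. disc_op a (\<lambda>w. cmod (f w)) z > ennreal m} + 2 * (m / l) powr (1 / a)"
proof -
  let ?S = "disc_op a (\<lambda>w. cmod (f w))"
  let ?A = "{z \<in> unit_disc. ?S z > ennreal m}" and ?B = "{z \<in> unit_disc. 1 - cmod z < (m / l) powr (1 / a)}"
  have A: "?A \<in> sets disc_area"
    by (rule disc_op_superlevel_sets) measurable
  have B: "?B \<in> sets disc_area"
  proof -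
    have "{z \<in> space disc_area. 1 - cmod z < (m / l) powr (1 / a)} \<in> sets disc_area" by measurable
    then show ?thesis by simp
  qed
  have sub: "{z \<in> unit_disc. cmod (K_op (2 + a) f z) > l} \<subseteq> ?A \<union> ?B"
  proof
    fix z assume "z \<in> {z \<in> unit_disc. cmod (K_op (2 + a) f z) > l}"
    then have z: "z \<in> unit_disc" and gt: "l < cmod (K_op (2 + a) f z)" by auto
    show "z \<in> ?A \<union> ?B"
    proof (cases "?S z > ennreal m")
      case False
      have pos: "1 - cmod z > 0" using z by simp
      have "ennreal (cmod (K_op (2 + a) f z)) \<le> ennreal ((1 - cmod z) powr (- a)) * ?S z"
        by (rule norm_K_op_le[OF f z])
      also have "\<dots> \<le> ennreal ((1 - cmod z) powr (- a)) * ennreal m"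
        using False by (intro mult_left_mono) auto
      also have "\<dots> = ennreal ((1 - cmod z) powr (- a) * m)" using m by (simp add: ennreal_mult)
      finally have "cmod (K_op (2 + a) f z) \<le> (1 - cmod z) powr (- a) * m"
        using m by (subst (asm) ennreal_le_iff) auto
      then have "l < (1 - cmod z) powr (- a) * m" using gt by linarith
      then have "(1 - cmod z) powr a < m / l"
        using pos l by (simp add: powr_minus field_simps)
      then have "((1 - cmod z) powr a) powr (1 / a) < (m / l) powr (1 / a)"
        using a by (intro powr_less_mono2) auto
      then have "1 - cmod z < (m / l) powr (1 / a)" using a pos by (simp add: powr_powr)
      then show ?thesis using z by simp
    qed (use z in simp)
  qed
  have "distr_fun (K_op (2 + a) f) l \<le> measure disc_area (?A \<union> ?B)"
    unfolding distr_fun_def using A B sub by (intro disc_area.finite_measure_mono) auto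
  also have "\<dots> \<le> measure disc_area ?A + measure disc_area ?B"
    using A B by (rule measure_Un_le)
  also have "measure disc_area ?B \<le> 2 * (m / l) powr (1 / a)"
    using emeasure_near_circle[of "(m / l) powr (1 / a)"] l m
    by (simp add: disc_area.emeasure_eq_measure)
  finally show ?thesis by simp
qed

lemma K_op_layer_int:
  assumes a: "a > 0" and p: "p > 1" and q: "q > 0" and pq: "1 / q = 1 / p + a" and r: "r > 0"
  obtains c where "c > 0"
    "\<And>f. f \<in> borel_measurable disc_area \<Longrightarrow>
      layer_int r (r / q) (distr_fun (K_op (2 + a) f)) \<le> ennreal c * layer_int r (r / p) (distr_fun f)"
proof -
  obtain c1 where c1: "c1 > 0" "\<And>f. f \<in> borel_measurable disc_area \<Longrightarrow>
      layer_int r (r / p) (\<lambda>s. measure disc_area {z \<in> unit_disc. disc_op a (\<lambda>w. cmod (f w)) z > ennreal s})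
        \<le> ennreal c1 * layer_int r (r / p) (distr_fun f)"
    by (rule disc_op_layer_int[OF a p r]) (rule that; blast)
  have p': "p > 0" and two: "(0::real) \<le> 2" using p by simp_all
  obtain c2 where c2: "c2 > 0" "\<And>D G. (\<And>s t. s \<le> t \<Longrightarrow> D t \<le> D s) \<Longrightarrow> (\<And>s. 0 \<le> D s) \<Longrightarrow> (\<And>s. D s \<le> 1) \<Longrightarrow> (\<And>l. 0 \<le> G l) \<Longrightarrow>
      (\<And>l m. l > 0 \<Longrightarrow> m > 0 \<Longrightarrow> G l \<le> D m + 2 * (m / l) powr (1 / a)) \<Longrightarrow>
      layer_int r (r / q) G \<le> ennreal c2 * layer_int r (r / p) D"
    by (rule layer_int_weak_multiplier[OF a q pq p' two r]) (rule that; blast)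
  show thesis
  proof (rule that[of "c2 * c1"])
    show "0 < c2 * c1" using c1 c2 by simp
    fix f :: "complex \<Rightarrow> complex" assume f [measurable]: "f \<in> borel_measurable disc_area"
    let ?E = "\<lambda>s. measure disc_area {z \<in> unit_disc. disc_op a (\<lambda>w. cmod (f w)) z > ennreal s}"
    have sets: "{z \<in> unit_disc. disc_op a (\<lambda>w. cmod (f w)) z > ennreal s} \<in> sets disc_area" for s
      by (rule disc_op_superlevel_sets) measurable
    have "layer_int r (r / q) (distr_fun (K_op (2 + a) f)) \<le> ennreal c2 * layer_int r (r / p) ?E"
    proof (rule c2(2))
      show "?E t \<le> ?E s" if "s \<le> t" for s t
        using that by (intro disc_area.finite_measure_mono sets) (auto intro: le_less_trans[OF ennreal_leI])
      show "?E s \<le> 1" for s by (rule measure_disc_area_le_1)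
      show "distr_fun (K_op (2 + a) f) l \<le> ?E m + 2 * (m / l) powr (1 / a)" if "l > 0" "m > 0" for l m
        using that by (intro distr_fun_K_op_le f a)
    qed auto
    also have "\<dots> \<le> ennreal c2 * (ennreal c1 * layer_int r (r / p) (distr_fun f))"
      by (intro mult_left_mono c1(2) f) simp
    also have "\<dots> = ennreal (c2 * c1) * layer_int r (r / p) (distr_fun f)"
      using c1 c2 by (simp add: ennreal_mult mult.assoc)
    finally show "layer_int r (r / q) (distr_fun (K_op (2 + a) f)) \<le> ennreal (c2 * c1) * layer_int r (r / p) (distr_fun f)" .
  qed
qed

lemma K_bounded_lorentz:
  assumes a: "a > 0" and p: "p > 1" and q: "q > 0" and pq: "1 / q = 1 / p + a" and r: "r > 0"
  shows "K_bounded (2 + a) (lorentz_space p r) (lorentz_norm p r) (lorentz_space q r) (lorentz_norm q r)"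
proof -
  obtain c where c: "c > 0" "\<And>f. f \<in> borel_measurable disc_area \<Longrightarrow>
      layer_int r (r / q) (distr_fun (K_op (2 + a) f)) \<le> ennreal c * layer_int r (r / p) (distr_fun f)"
    by (rule K_op_layer_int[OF a p q pq r]) (rule that; blast)
  show ?thesis
    unfolding K_bounded_def
  proof (intro exI[of _ "(q * c / p) powr (1 / r)"] ballI conjI)
    fix f assume "f \<in> lorentz_space p r"
    then have f: "f \<in> borel_measurable disc_area" and fin: "lorentz_norm p r f < \<infinity>"
      by (auto simp: lorentz_space_def)
    have "layer_int r (r / p) (distr_fun f) < \<infinity>"
      using fin p unfolding lorentz_norm_conv_layer_int epowr_less_top
      by (auto simp: less_top[symmetric] ennreal_mult_eq_top_iff)
    then have int: "integrable disc_area f"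
      by (rule integrable_of_layer_int_finite[OF f p r])
    show "integrable disc_area (K_integrand (2 + a) f z)" if "z \<in> unit_disc" for z
      using that a by (intro integrable_K_integrand int) auto
    have "ennreal q * layer_int r (r / q) (distr_fun (K_op (2 + a) f))
        \<le> ennreal q * (ennreal c * layer_int r (r / p) (distr_fun f))"
      by (intro mult_left_mono c(2) f) simp
    also have "\<dots> = ennreal (q * c / p) * (ennreal p * layer_int r (r / p) (distr_fun f))"
      using p q c(1) by (simp add: mult.assoc[symmetric] ennreal_mult[symmetric])
    finally show le: "lorentz_norm q r (K_op (2 + a) f) \<le> ennreal ((q * c / p) powr (1 / r)) * lorentz_norm p r f"
      unfolding lorentz_norm_conv_layer_int using p q r c(1) by (intro epowr_le) auto
    also have "\<dots> < \<infinity>" using fin by (simp add: ennreal_mult_less_top)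
    finally show "K_op (2 + a) f \<in> lorentz_space q r"
      using borel_measurable_K_op[OF f] by (simp add: lorentz_space_def)
  qed
qed

lemma K_bounded_weak:
  assumes a: "a > 0" and p: "p > 1" and q: "q > 0" and pq: "1 / q = 1 / p + a"
  shows "K_bounded (2 + a) (Lp_space p) (Lp_norm p) (weak_space q) (weak_norm q)"
proof -
  have p0: "p > 0" using p by simp
  obtain C where C: "\<And>f. f \<in> lorentz_space p p \<Longrightarrow>
      (\<forall>z\<in>unit_disc. integrable disc_area (K_integrand (2 + a) f z)) \<and> K_op (2 + a) f \<in> lorentz_space q p \<and>
      lorentz_norm q p (K_op (2 + a) f) \<le> ennreal C * lorentz_norm p p f"
    using K_bounded_lorentz[OF a p q pq p0] unfolding K_bounded_def by blast
  show ?thesis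
    unfolding K_bounded_def
  proof (intro exI[of _ "(p / q) powr (1 / p) * max 0 C"] ballI)
    fix f assume "f \<in> Lp_space p"
    then have f: "f \<in> borel_measurable disc_area" and fin: "Lp_norm p f < \<infinity>"
      by (auto simp: Lp_space_def)
    have norm_eq: "Lp_norm p f = lorentz_norm p p f" by (rule Lp_norm_conv_lorentz_norm[OF p0 f])
    have "f \<in> lorentz_space p p" using f fin norm_eq by (simp add: lorentz_space_def)
    note * = C[OF this]
    have "weak_norm q (K_op (2 + a) f) \<le> ennreal ((p / q) powr (1 / p)) * lorentz_norm q p (K_op (2 + a) f)"
      by (rule weak_norm_le_lorentz_norm[OF q p0 borel_measurable_K_op[OF f]])
    also have "\<dots> \<le> ennreal ((p / q) powr (1 / p)) * (ennreal (max 0 C) * lorentz_norm p p f)"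
      using * by (intro mult_left_mono) (auto simp: ennreal_max_0)
    finally have le: "weak_norm q (K_op (2 + a) f) \<le> ennreal ((p / q) powr (1 / p) * max 0 C) * Lp_norm p f"
      by (simp add: norm_eq ennreal_mult mult.assoc)
    also have "\<dots> < \<infinity>" using fin by (simp add: ennreal_mult_less_top)
    finally have "K_op (2 + a) f \<in> weak_space q"
      using borel_measurable_K_op[OF f] by (simp add: weak_space_def)
    then show "(\<forall>z\<in>unit_disc. integrable disc_area (K_integrand (2 + a) f z)) \<and> K_op (2 + a) f \<in> weak_space q \<and>
        weak_norm q (K_op (2 + a) f) \<le> ennreal ((p / q) powr (1 / p) * max 0 C) * Lp_norm p f"
      using * le by blast
  qed
qed

theorem corollary4p5:
  fixes t p q :: real
  assumes "1 < t" and "t < 3 / 2"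
    and "(1 / p, 1 / q) \<in> {0<..<1} \<times> {0<..<1}"
    and "1 / q - 1 / p = 2 * t - 2"
  shows "(\<forall>r::real. r > 0 \<longrightarrow> K_bounded (2 * t) (lorentz_space p r) (lorentz_norm p r)
                                  (lorentz_space q r) (lorentz_norm q r))
    \<and> K_bounded (2 * t) (Lp_space p) (Lp_norm p) (weak_space q) (weak_norm q)"
proof -
  define a where "a = 2 * t - 2"
  have a: "a > 0" and t: "2 * t = 2 + a" using assms(1) by (auto simp: a_def)
  have p: "p > 1" and q: "q > 0" using assms(3) by (auto simp: field_simps split: if_splits)
  have pq: "1 / q = 1 / p + a" using assms(4) by (simp add: a_def)
  show ?thesis
    unfolding t using K_bounded_lorentz[OF a p q pq] K_bounded_weak[OF a p q pq] by blast
qed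

end
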